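(* Let $\langle X,(A_i)_{i\in X},p,r,\gamma\rangle$ be a finite Markov Decision Process with $n$ states, a total of $m$ actions, and discount factor $\gamma\in(0,1)$, and let $\tau_t$, $\tau_r$ be its structural constants (defined in the context; they do not depend on $\gamma$). Then Simplex-PI (started from any policy) terminates after at most $$\Big[m\lceil n\tau_r\log(n^2\tau_r)\rceil+(m-n)\lceil n\tau_r\log(n^2\tau_t)\rceil\Big]\Big[(m-n)\lceil n^2\tau_t\log(n^2\tau_t)\rceil+n\lceil n^2\tau_t\log(n^2)\rceil\Big]=\tilde O\left(n^3m^2\tau_t\tau_r\right)$$ iterations, where $\tilde O$ hides logarithmic factors.
   Context: A finite Markov Decision Process (MDP) consists of a state space $X=\{1,\dots,n\}$; a finite action space $A$ of size $m$, partitioned into nonempty sets $A_i$ ($i\in X$), where $A_i$ is the set of admissible actions in state $i$; transition probabilities $p_{ij}(a)=\mathbb{P}(i_{t+1}=j\mid i_t=i,a_t=a)$ for $a\in A_i$; a reward function $r(i,a,j)\in\mathbb{R}$; and a discount factor $\gamma\in(0,1)$. A policy is a map $\pi:X\to A$ with $\pi(i)\in A_i$ for all $i$. Let $P_\pi$ be the $n\times n$ stochastic matrix with entries $p_{ij}(\pi(i))$ and $r_\pi$ the vector with components $\sum_j p_{ij}(\pi(i))r(i,\pi(i),j)$. The operator $T_\pi$ is $T_\pi v=r_\pi+\gamma P_\pi v$, and the value $v_\pi\in\mathbb{R}^n$ of $\pi$ is its unique fixed point. The optimal value is $v_*=\max_\pi v_\pi$ (componentwise); a policy is optimal if its value is $v_*$.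 Let $Tv=\max_\pi T_\pi v$ (componentwise); a policy $\pi$ is greedy with respect to $v$ if $T_\pi v=Tv$, and $\mathcal{G}(v)$ denotes any such policy. The maximal advantage with respect to $\pi$ is $a_\pi=Tv_\pi-v_\pi\ge 0$, and $S_\pi=\{i: a_\pi(i)>0\}$; $\pi$ is optimal iff $S_\pi=\emptyset$. For nonempty $Y\subseteq S_\pi$, $\mathrm{switch}(\pi,Y)$ is the policy equal to $\mathcal{G}(v_\pi)(i)$ for $i\in Y$ and to $\pi(i)$ for $i\notin Y$. Simplex-PI generates, from an initial policy $\pi_0$, the sequence $\pi_{k+1}=\mathrm{switch}(\pi_k,\{i_k\})$ where $i_k\in\arg\max_i a_{\pi_k}(i)$. It terminates when $\pi_k$ is optimal; one iteration is one update $\pi_k\to\pi_{k+1}$. $\log$ is the natural logarithm. Structural constants: for a policy $\pi$, state $i$ and time $t$, let $\tau^\pi(i,t)=\sum_{k=0}^{t-1}\mathbb{P}(i_k=i\mid i_0\sim U,\ a_k=\pi(i_k))$, where $U$ is the uniform distribution on $X$ (expected time spent in $i$ until time $t-1$ when following $\pi$ from $U$), and let $\mu^\pi(i)=\lim_{t\to\infty}\frac1t\tau^\pi(i,t)$. A state is transient (resp. recurrent) for $\pi$ if it is so for the Markov chain $P_\pi$. The constants $\tau_t$ and $\tau_r$ are the smallest finite constants such that for all policies $\pi$ and states $i$: if $i$ is transient for $\pi$ then $\lim_{t\to\infty}\tau^\pi(i,t)\le\tau_t$; if $i$ is recurrent for $\pi$ then $\frac{1}{\mu^\pi(i)}\l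e\tau_r$.
   Formalization: If no policy has a transient state (always so when n = 1), no smallest constant τ_t exists and the bound is undefined; in that case the result is stated and proved for every real τ_t with n²τ_t > 1. *)

theory Defs
  imports "HOL-Probability.Probability" "HOL-Library.Landau_Symbols"
begin

record 'a mdp =
  num_states :: nat
  actions :: "nat \<Rightarrow> 'a set"
  kernel :: "nat \<Rightarrow> 'a \<Rightarrow> nat pmf"
  reward :: "nat \<Rightarrow> 'a \<Rightarrow> nat \<Rightarrow> real"
  discount :: real

definition states :: "'a mdp \<Rightarrow> nat set" where
  "states M = {1..num_states M}"

definition all_actions :: "'a mdp \<Rightarrow> 'a set" where
  "all_actions M = (\<Union>i\<in>states M. actions M i)"

definition num_actions :: "'a mdp \<Rightarrow> nat" where
  "num_actions M = card (all_actions M)"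

definition finite_mdp :: "'a mdp \<Rightarrow> bool" where
  "finite_mdp M \<longleftrightarrow>
     1 \<le> num_states M \<and>
     finite (all_actions M) \<and>
     (\<forall>i\<in>states M. actions M i \<noteq> {}) \<and>
     disjoint_family_on (actions M) (states M) \<and>
     (\<forall>i\<in>states M. \<forall>a\<in>actions M i. set_pmf (kernel M i a) \<subseteq> states M) \<and>
     0 < discount M \<and> discount M < 1"

definition policies :: "'a mdp \<Rightarrow> (nat \<Rightarrow> 'a) set" where
  "policies M = (\<Pi>\<^sub>E i\<in>states M. actions M i)"

definition trans_prob :: "'a mdp \<Rightarrow> (nat \<Rightarrow> 'a) \<Rightarrow> nat \<Rightarrow> nat \<Rightarrow> real" where
  "trans_prob M \<pi> i j = pmf (kernel M i (\<pi> i)) j"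

definition policy_reward :: "'a mdp \<Rightarrow> (nat \<Rightarrow> 'a) \<Rightarrow> nat \<Rightarrow> real" where
  "policy_reward M \<pi> i = (\<Sum>j\<in>states M. trans_prob M \<pi> i j * reward M i (\<pi> i) j)"

text \<open>
  Elements of $R^n$ are functions that are \<^const>\<open>undefined\<close> outside \<^const>\<open>states\<close>; the
  operators below return such functions, so that equality of functions is equality of vectors.
\<close>

definition bellman_pol :: "'a mdp \<Rightarrow> (nat \<Rightarrow> 'a) \<Rightarrow> (nat \<Rightarrow> real) \<Rightarrow> nat \<Rightarrow> real" where
  "bellman_pol M \<pi> v =
     (\<lambda>i\<in>states M. policy_reward M \<pi> i + discount M * (\<Sum>j\<in>states M. trans_prob M \<pi> i j * v j))"

definition val :: "'a mdp \<Rightarrow> (nat \<Rightarrow> 'a) \<Rightarrow> nat \<Rightarrow> real" where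
  "val M \<pi> = (THE v. bellman_pol M \<pi> v = v)"

definition opt_val :: "'a mdp \<Rightarrow> nat \<Rightarrow> real" where
  "opt_val M = (\<lambda>i\<in>states M. Max ((\<lambda>\<pi>. val M \<pi> i) ` policies M))"

definition optimal :: "'a mdp \<Rightarrow> (nat \<Rightarrow> 'a) \<Rightarrow> bool" where
  "optimal M \<pi> \<longleftrightarrow> val M \<pi> = opt_val M"

definition bellman :: "'a mdp \<Rightarrow> (nat \<Rightarrow> real) \<Rightarrow> nat \<Rightarrow> real" where
  "bellman M v = (\<lambda>i\<in>states M. Max ((\<lambda>\<pi>. bellman_pol M \<pi> v i) ` policies M))"

definition greedy :: "'a mdp \<Rightarrow> (nat \<Rightarrow> real) \<Rightarrow> (nat \<Rightarrow> 'a) \<Rightarrow> bool" where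
  "greedy M v \<pi> \<longleftrightarrow> \<pi> \<in> policies M \<and> bellman_pol M \<pi> v = bellman M v"

definition advantage :: "'a mdp \<Rightarrow> (nat \<Rightarrow> 'a) \<Rightarrow> nat \<Rightarrow> real" where
  "advantage M \<pi> i = bellman M (val M \<pi>) i - val M \<pi> i"

text \<open>
  A switch depends on the choice \<open>g\<close> of a greedy policy; the choice is left open at every step, and
  likewise the choice among the maximisers of the advantage.
\<close>

definition switch :: "(nat \<Rightarrow> 'a) \<Rightarrow> (nat \<Rightarrow> 'a) \<Rightarrow> nat set \<Rightarrow> nat \<Rightarrow> 'a" where
  "switch g \<pi> Y = (\<lambda>i. if i \<in> Y then g i else \<pi> i)"

definition simplex_step :: "'a mdp \<Rightarrow> (nat \<Rightarrow> 'a) \<Rightarrow> (nat \<Rightarrow> 'a) \<Rightarrow> bool" where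
  "simplex_step M \<pi> \<pi>' \<longleftrightarrow>
     (\<exists>g i. greedy M (val M \<pi>) g \<and>
            is_arg_max (advantage M \<pi>) (\<lambda>j. j \<in> states M) i \<and>
            \<pi>' = switch g \<pi> {i})"

text \<open>
  The entries of the sequence after the first optimal policy are irrelevant and unconstrained.
\<close>

definition simplex_pi_run :: "'a mdp \<Rightarrow> (nat \<Rightarrow> nat \<Rightarrow> 'a) \<Rightarrow> bool" where
  "simplex_pi_run M \<pi>s \<longleftrightarrow>
     \<pi>s 0 \<in> policies M \<and>
     (\<forall>k. \<not> optimal M (\<pi>s k) \<longrightarrow> simplex_step M (\<pi>s k) (\<pi>s (Suc k)))"

primrec state_law :: "'a mdp \<Rightarrow> (nat \<Rightarrow> 'a) \<Rightarrow> nat \<Rightarrow> nat pmf" where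
  "state_law M \<pi> 0 = pmf_of_set (states M)"
| "state_law M \<pi> (Suc k) = bind_pmf (state_law M \<pi> k) (\<lambda>i. kernel M i (\<pi> i))"

definition occupation :: "'a mdp \<Rightarrow> (nat \<Rightarrow> 'a) \<Rightarrow> nat \<Rightarrow> nat \<Rightarrow> real" where
  "occupation M \<pi> i t = (\<Sum>k<t. pmf (state_law M \<pi> k) i)"

definition frequency :: "'a mdp \<Rightarrow> (nat \<Rightarrow> 'a) \<Rightarrow> nat \<Rightarrow> real" where
  "frequency M \<pi> i = lim (\<lambda>t. occupation M \<pi> i t / real t)"

text \<open>
  \<open>first_passage M \<pi> j t i\<close> is the probability that the chain started in \<open>i\<close> visits \<open>j\<close>, at a time
  at least 1, for the first time at time \<open>t + 1\<close>.
\<close>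

primrec first_passage :: "'a mdp \<Rightarrow> (nat \<Rightarrow> 'a) \<Rightarrow> nat \<Rightarrow> nat \<Rightarrow> nat \<Rightarrow> real" where
  "first_passage M \<pi> j 0 i = trans_prob M \<pi> i j"
| "first_passage M \<pi> j (Suc t) i =
     (\<Sum>k\<in>states M - {j}. trans_prob M \<pi> i k * first_passage M \<pi> j t k)"

definition recurrent :: "'a mdp \<Rightarrow> (nat \<Rightarrow> 'a) \<Rightarrow> nat \<Rightarrow> bool" where
  "recurrent M \<pi> i \<longleftrightarrow> (\<lambda>t. first_passage M \<pi> i t i) sums 1"

definition transient :: "'a mdp \<Rightarrow> (nat \<Rightarrow> 'a) \<Rightarrow> nat \<Rightarrow> bool" where
  "transient M \<pi> i \<longleftrightarrow> \<not> recurrent M \<pi> i"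

definition smallest :: "(real \<Rightarrow> bool) \<Rightarrow> real \<Rightarrow> bool" where
  "smallest P c \<longleftrightarrow> P c \<and> (\<forall>d. P d \<longrightarrow> c \<le> d)"

definition transient_bound :: "'a mdp \<Rightarrow> real \<Rightarrow> bool" where
  "transient_bound M c \<longleftrightarrow>
     (\<forall>\<pi>\<in>policies M. \<forall>i\<in>states M. transient M \<pi> i \<longrightarrow> lim (occupation M \<pi> i) \<le> c)"

definition recurrent_bound :: "'a mdp \<Rightarrow> real \<Rightarrow> bool" where
  "recurrent_bound M c \<longleftrightarrow>
     (\<forall>\<pi>\<in>policies M. \<forall>i\<in>states M. recurrent M \<pi> i \<longrightarrow> 1 / frequency M \<pi> i \<le> c)"

text \<open>
  If no policy has a transient state, every real number satisfies \<^const>\<open>transient_bound\<close> and there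
  is no smallest one. In that case \<open>\<tau>\<^sub>t\<close> may be any number for which $\log(n^2\tau_t)$ is positive.
  (If there are transient states, $n^2\tau_t \ge n$ holds automatically, because a transient state
  has probability $1/n$ at time 0.)
\<close>

definition structural_constants :: "'a mdp \<Rightarrow> real \<Rightarrow> real \<Rightarrow> bool" where
  "structural_constants M \<tau>\<^sub>t \<tau>\<^sub>r \<longleftrightarrow>
     (if \<exists>\<pi>\<in>policies M. \<exists>i\<in>states M. transient M \<pi> i
      then smallest (transient_bound M) \<tau>\<^sub>t
      else 1 < real (num_states M) ^ 2 * \<tau>\<^sub>t) \<and>
     smallest (recurrent_bound M) \<tau>\<^sub>r"

definition iteration_bound :: "nat \<Rightarrow> nat \<Rightarrow> real \<Rightarrow> real \<Rightarrow> int" where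
  "iteration_bound n m \<tau>\<^sub>t \<tau>\<^sub>r =
     (int m * \<lceil>n * \<tau>\<^sub>r * ln (n ^ 2 * \<tau>\<^sub>r)\<rceil>
        + (int m - int n) * \<lceil>n * \<tau>\<^sub>r * ln (n ^ 2 * \<tau>\<^sub>t)\<rceil>) *
     ((int m - int n) * \<lceil>n ^ 2 * \<tau>\<^sub>t * ln (n ^ 2 * \<tau>\<^sub>t)\<rceil>
        + int n * \<lceil>n ^ 2 * \<tau>\<^sub>t * ln (n ^ 2)\<rceil>)"

definition soft_bigo :: "'b filter \<Rightarrow> ('b \<Rightarrow> real) \<Rightarrow> ('b \<Rightarrow> real) set" where
  "soft_bigo F g = {f. \<exists>k::nat. f \<in> O[F](\<lambda>x. g x * ln (g x) ^ k)}"

text \<open>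
  The set over which the soft-O estimate is uniform: all finite MDPs with their structural constants.
\<close>

definition mdp_instances :: "('a mdp \<times> real \<times> real) set" where
  "mdp_instances = {(M, \<tau>\<^sub>t, \<tau>\<^sub>r). finite_mdp M \<and> structural_constants M \<tau>\<^sub>t \<tau>\<^sub>r}"

end

(*
  For the discounted visit counts x(i) of a policy, started with mass 1 in every state, one has
  sum (v' - v) = sum x'(i) (T' v - v)(i).  Here x >= 1, x(i) <= n tau_t at transient states, and
  1 / ((1 - gamma) tau_r) <= x(i) <= n / (1 - gamma) at recurrent ones; the lower bound holds because
  the Cesaro limit of the laws of the chain is an invariant vector below the initial mass.

  Call a step creating if the switched state is recurrent afterwards.  A creating step shrinks the
  distance to the optimal value by the factor 1 - 1/(n tau_r).  Between creating steps the
  recurrent states can only decrease, and every step shrinks the distance to the value at the end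
  of the stretch by 1 - 1/(n^2 tau_t).  In both cases some action carries a share of the distance,
  so it can no longer be used once the distance is too small for that action; counting the
  actions (and the states that stop being recurrent) bounds the number of steps.
*)

theory Submission
  imports Defs
begin

section \<open>Finite Markov chains\<close>

text \<open>The obstacle is to keep the discount factor out of the bound. A factor
  \<open>1 / (1 - \<gamma>)\<close> cancels when an upper bound \<open>n / (1 - \<gamma>)\<close>
  meets the lower bound at a recurrent state, and it never occurs when a bound at a transient state
  meets the trivial lower bound \<open>1\<close>. So the labels that count creating steps record,
  besides state and action, whether the state is recurrent. At a step that is not creating, the
  switched state may be visited about once while an optimal policy visits its recurrent states about
  \<open>1 / (1 - \<gamma>)\<close> times; no discount-free contraction towards the optimal value
  follows, which is why the target is changed there. The structural constants involve limits of
  averages, and the powers of a periodic chain need not converge; the Cesaro limit is therefore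
  obtained from compactness and uniqueness of limit points, and recurrence, defined by first
  passage, is identified with positive frequency. With a single state \<open>ln (n ^ 2)\<close>
  vanishes, so the slack used in the general bound is missing and this case is treated
  apart.\<close>

lemma bounded_family_convergent_subseq:
  fixes f :: "nat \<Rightarrow> 'i \<Rightarrow> real"
  assumes "finite S" and "\<And>n i. i \<in> S \<Longrightarrow> \<bar>f n i\<bar> \<le> B"
  shows "\<exists>r. strict_mono (r :: nat \<Rightarrow> nat) \<and> (\<forall>i\<in>S. convergent (\<lambda>n. f (r n) i))"
  using assms
proof (induction S rule: finite_induct)
  case empty
  then show ?case by (auto intro!: exI[of _ id] strict_mono_id)
next
  case (insert x F)
  then obtain r where r: "strict_mono r" "\<forall>i\<in>F. convergent (\<lambda>n. f (r n) i)" by auto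
  have "bounded (range (\<lambda>n. f (r n) x))"
    using insert.prems[of x] by (auto simp: bounded_iff)
  from bounded_imp_convergent_subsequence[OF this]
  obtain l r' where r': "strict_mono r'" "((\<lambda>n. f (r n) x) \<circ> r') \<longlonglongrightarrow> l" by auto
  have "convergent (\<lambda>n. f ((r \<circ> r') n) i)" if "i \<in> insert x F" for i
  proof (cases "i = x")
    case True
    then show ?thesis using r'(2) by (auto simp: convergent_def o_def)
  next
    case False
    then have "convergent (\<lambda>n. f (r n) i)" using that r by auto
    from convergent_subseq_convergent[OF this r'(1)] show ?thesis by (simp add: o_def)
  qed
  moreover have "strict_mono (r \<circ> r')" using r(1) r'(1) by (rule strict_mono_o)
  ultimately show ?case by blast
qed

text \<open>If convergence failed, the indices at distance at least \<open>e\<close> from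
  \<open>L\<close> would form a subsequence without any further subsequence tending to
  \<open>L\<close>.\<close>

lemma LIMSEQ_if_subseq_limits_unique:
  fixes X :: "nat \<Rightarrow> real"
  assumes "\<And>r. strict_mono (r :: nat \<Rightarrow> nat) \<Longrightarrow> \<exists>r'. strict_mono (r' :: nat \<Rightarrow> nat) \<and> (X \<circ> r \<circ> r') \<longlonglongrightarrow> L"
  shows "X \<longlonglongrightarrow> L"
proof (rule ccontr)
  assume "\<not> X \<longlonglongrightarrow> L"
  then obtain e where e: "e > 0" "\<And>N. \<exists>n\<ge>N. \<not> dist (X n) L < e"
    unfolding lim_sequentially by blast
  then have inf: "infinite {n. \<not> dist (X n) L < e}"
    by (auto simp: infinite_nat_iff_unbounded_le)
  define r where "r = enumerate {n. \<not> dist (X n) L < e}"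
  have r: "strict_mono r" unfolding r_def using inf by (rule strict_mono_enumerate)
  obtain r' where r': "strict_mono r'" "(X \<circ> r \<circ> r') \<longlonglongrightarrow> L" using assms[OF r] by blast
  then obtain n where "dist ((X \<circ> r \<circ> r') n) L < e"
    using e(1) unfolding lim_sequentially by blast
  moreover have "r (r' n) \<in> {n. \<not> dist (X n) L < e}"
    unfolding r_def by (rule enumerate_in_set[OF inf])
  ultimately show False by simp
qed

lemma mult_delta:
  fixes f :: "'i \<Rightarrow> real"
  assumes "finite S"
  shows "i \<in> S \<Longrightarrow> (\<Sum>l\<in>S. (if i = l then 1 else 0) * f l) = f i"
    and "i \<in> S \<Longrightarrow> (\<Sum>l\<in>S. f l * (if l = i then 1 else 0)) = f i"
  using assms by (simp_all add: if_distrib[of "(*) _"] if_distrib[of "\<lambda>x. x * _"] cong: if_cong)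

lemma eventually_subseq_pos:
  assumes "strict_mono (r :: nat \<Rightarrow> nat)"
  shows "\<forall>\<^sub>F t in sequentially. r t > 0"
  using eventually_gt_at_top[of 0]
proof eventually_elim
  fix t :: nat assume "t > 0"
  then show "r t > 0" using seq_suble[OF assms, of t] by simp
qed

locale finite_chain =
  fixes S :: "'i set" and P :: "'i \<Rightarrow> 'i \<Rightarrow> real"
  assumes finS: "finite S" and neS: "S \<noteq> {}"
    and P_nonneg: "0 \<le> P i j"
    and P_sum: "i \<in> S \<Longrightarrow> (\<Sum>j\<in>S. P i j) = 1"
begin

section \<open>Powers of the transition matrix and their Cesaro averages\<close>

primrec pw :: "nat \<Rightarrow> 'i \<Rightarrow> 'i \<Rightarrow> real" where
  "pw 0 i j = (if i = j then 1 else 0)"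
| "pw (Suc k) i j = (\<Sum>l\<in>S. P i l * pw k l j)"

lemma pw_nonneg: "0 \<le> pw k i j"
  by (induction k arbitrary: i) (auto intro!: sum_nonneg mult_nonneg_nonneg P_nonneg)

lemma pw_sum: "i \<in> S \<Longrightarrow> (\<Sum>j\<in>S. pw k i j) = 1"
proof (induction k arbitrary: i)
  case 0
  then show ?case using finS by simp
next
  case (Suc k)
  have "(\<Sum>j\<in>S. pw (Suc k) i j) = (\<Sum>l\<in>S. P i l * (\<Sum>j\<in>S. pw k l j))"
    by (simp add: sum_distrib_left) (rule sum.swap)
  also have "\<dots> = 1" using Suc P_sum by simp
  finally show ?case .
qed

lemma pw_le_1: "i \<in> S \<Longrightarrow> j \<in> S \<Longrightarrow> pw k i j \<le> 1"
  using member_le_sum[of j S "pw k i"] finS pw_nonneg pw_sum[of i] by auto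

lemma pw_Suc_right: "i \<in> S \<Longrightarrow> j \<in> S \<Longrightarrow> pw (Suc k) i j = (\<Sum>l\<in>S. pw k i l * P l j)"
proof (induction k arbitrary: i)
  case 0
  then show ?case using finS by (simp add: mult_delta)
next
  case (Suc k)
  have "pw (Suc (Suc k)) i j = (\<Sum>l\<in>S. P i l * (\<Sum>l'\<in>S. pw k l l' * P l' j))"
    using Suc by (subst pw.simps) (intro sum.cong refl, simp del: pw.simps)
  also have "\<dots> = (\<Sum>l'\<in>S. (\<Sum>l\<in>S. P i l * pw k l l') * P l' j)"
    by (simp add: sum_distrib_left sum_distrib_right mult.assoc) (rule sum.swap)
  finally show ?case by simp
qed

definition ces :: "nat \<Rightarrow> 'i \<Rightarrow> 'i \<Rightarrow> real" where
  "ces t i j = (\<Sum>k<t. pw k i j) / t"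

lemma ces_nonneg: "0 \<le> ces t i j"
  by (auto simp: ces_def intro!: divide_nonneg_nonneg sum_nonneg pw_nonneg)

lemma ces_bound: "i \<in> S \<Longrightarrow> j \<in> S \<Longrightarrow> \<bar>ces t i j\<bar> \<le> 1"
proof -
  assume "i \<in> S" "j \<in> S"
  then have "(\<Sum>k<t. pw k i j) \<le> (\<Sum>k<t. 1)" by (intro sum_mono pw_le_1)
  then have "ces t i j \<le> 1" by (auto simp: ces_def divide_le_eq)
  then show ?thesis using ces_nonneg[of t i j] by simp
qed

lemma pw_div_tendsto_0:
  assumes "i \<in> S" "j \<in> S"
  shows "(\<lambda>t. pw t i j / t) \<longlonglongrightarrow> 0"
proof (rule tendsto_sandwich[of "\<lambda>_. 0" _ _ "\<lambda>t. 1 / real t"])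
  show "\<forall>\<^sub>F t in sequentially. pw t i j / t \<le> 1 / t"
    using assms by (intro always_eventually allI divide_right_mono pw_le_1) auto
qed (auto simp: pw_nonneg lim_1_over_n)

text \<open>Convergence of all entries along one common subsequence. For \<open>r = id\<close> it is
  genuine convergence, so the same invariance lemmas serve before and after the limit is known to
  exist.\<close>

definition limit_point :: "(nat \<Rightarrow> nat) \<Rightarrow> ('i \<Rightarrow> 'i \<Rightarrow> real) \<Rightarrow> bool" where
  "limit_point r Q \<longleftrightarrow> strict_mono r \<and> (\<forall>i\<in>S. \<forall>j\<in>S. (\<lambda>t. ces (r t) i j) \<longlonglongrightarrow> Q i j)"

lemma ex_limit_point:
  assumes "strict_mono (r :: nat \<Rightarrow> nat)"
  shows "\<exists>r' Q. strict_mono r' \<and> limit_point (r \<circ> r') Q"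
proof -
  obtain r' where r': "strict_mono r'"
      "\<forall>p\<in>S\<times>S. convergent (\<lambda>n. ces (r (r' n)) (fst p) (snd p))"
    using bounded_family_convergent_subseq[of "S\<times>S" "\<lambda>n p. ces (r n) (fst p) (snd p)" 1]
      finS ces_bound by auto
  have "limit_point (r \<circ> r') (\<lambda>i j. lim (\<lambda>n. ces (r (r' n)) i j))"
    using r' assms by (auto simp: limit_point_def convergent_LIMSEQ_iff intro: strict_mono_o)
  then show ?thesis using r'(1) by blast
qed

lemma limit_point_mono: "limit_point r Q \<Longrightarrow> strict_mono r"
  by (simp add: limit_point_def)

lemma limit_point_lim: "limit_point r Q \<Longrightarrow> i \<in> S \<Longrightarrow> j \<in> S \<Longrightarrow> (\<lambda>t. ces (r t) i j) \<longlonglongrightarrow> Q i j"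
  by (simp add: limit_point_def)

text \<open>Moving the window of times by one changes only two boundary terms of order
  \<open>1 / t\<close>; this makes every limit point invariant.\<close>

lemma ces_shift: "t > 0 \<Longrightarrow> (\<Sum>k<t. pw (Suc k) i j) / t = ces t i j + pw t i j / t - pw 0 i j / t"
  using sum.lessThan_Suc_shift[of "\<lambda>k. pw k i j" t] 
  by (simp add: ces_def field_simps del: pw.simps)

lemma ces_shift_lim:
  assumes "limit_point r Q" "i \<in> S" "j \<in> S"
  shows "(\<lambda>t. (\<Sum>k<r t. pw (Suc k) i j) / r t) \<longlonglongrightarrow> Q i j"
proof -
  note r = limit_point_mono[OF assms(1)]
  have "(\<lambda>t. ces (r t) i j + pw (r t) i j / r t - pw 0 i j * (1 / r t)) \<longlonglongrightarrow> Q i j + 0 - pw 0 i j * 0"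
    using LIMSEQ_subseq_LIMSEQ[OF pw_div_tendsto_0[OF assms(2,3)] r]
      LIMSEQ_subseq_LIMSEQ[OF lim_1_over_n r]
    by (intro tendsto_add tendsto_diff tendsto_mult tendsto_const limit_point_lim[OF assms])
       (simp_all only: o_def)
  moreover have "\<forall>\<^sub>F t in sequentially. ces (r t) i j + pw (r t) i j / r t - pw 0 i j * (1 / r t) =
     (\<Sum>k<r t. pw (Suc k) i j) / r t"
    using eventually_subseq_pos[OF r] by eventually_elim (simp add: ces_shift del: pw.simps)
  ultimately show ?thesis by (auto intro: Lim_transform_eventually)
qed

text \<open>By linearity the shifted average is \<open>P\<close> applied to the average, and both
  have the same limit. In \<open>limit_point_right\<close> the powers are unfolded at the last step
  instead.\<close>

lemma limit_point_left:
  assumes "limit_point r Q" "i \<in> S" "j \<in> S"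
  shows "(\<Sum>l\<in>S. P i l * Q l j) = Q i j"
proof (rule LIMSEQ_unique[OF _ ces_shift_lim[OF assms]])
  have "(\<lambda>t. \<Sum>l\<in>S. P i l * ces (r t) l j) \<longlonglongrightarrow> (\<Sum>l\<in>S. P i l * Q l j)"
    using limit_point_lim[OF assms(1) _ assms(3)] by (intro tendsto_intros) auto
  moreover have "(\<Sum>l\<in>S. P i l * ces t l j) = (\<Sum>k<t. pw (Suc k) i j) / t" for t
  proof -
    have "(\<Sum>k<t. pw (Suc k) i j) = (\<Sum>l\<in>S. P i l * (\<Sum>k<t. pw k l j))"
      by (simp add: sum_distrib_left) (rule sum.swap)
    then show ?thesis by (simp add: ces_def del: pw.simps flip: sum_divide_distrib)
  qed
  ultimately show "(\<lambda>t. (\<Sum>k<r t. pw (Suc k) i j) / r t) \<longlonglongrightarrow> (\<Sum>l\<in>S. P i l * Q l j)" by simp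
qed

lemma limit_point_right:
  assumes "limit_point r Q" "i \<in> S" "j \<in> S"
  shows "(\<Sum>l\<in>S. Q i l * P l j) = Q i j"
proof (rule LIMSEQ_unique[OF _ ces_shift_lim[OF assms]])
  have "(\<lambda>t. \<Sum>l\<in>S. ces (r t) i l * P l j) \<longlonglongrightarrow> (\<Sum>l\<in>S. Q i l * P l j)"
    using limit_point_lim[OF assms(1,2)] by (intro tendsto_intros) auto
  moreover have "(\<Sum>l\<in>S. ces t i l * P l j) = (\<Sum>k<t. pw (Suc k) i j) / t" for t
  proof -
    have "(\<Sum>k<t. pw (Suc k) i j) = (\<Sum>k<t. \<Sum>l\<in>S. pw k i l * P l j)"
      using assms by (intro sum.cong refl pw_Suc_right)
    also have "\<dots> = (\<Sum>l\<in>S. (\<Sum>k<t. pw k i l) * P l j)"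
      by (simp add: sum_distrib_right) (rule sum.swap)
    finally show ?thesis by (simp add: ces_def del: pw.simps flip: sum_divide_distrib)
  qed
  ultimately show "(\<lambda>t. (\<Sum>k<r t. pw (Suc k) i j) / r t) \<longlonglongrightarrow> (\<Sum>l\<in>S. Q i l * P l j)" by simp
qed

lemma limit_point_right_pw:
  assumes "limit_point r Q" "i \<in> S" "j \<in> S"
  shows "(\<Sum>l\<in>S. Q i l * pw k l j) = Q i j"
  using assms(3)
proof (induction k arbitrary: j)
  case 0
  then show ?case using finS by (simp add: mult_delta)
next
  case (Suc k)
  have "(\<Sum>l\<in>S. Q i l * pw (Suc k) l j) = (\<Sum>l'\<in>S. (\<Sum>l\<in>S. Q i l * P l l') * pw k l' j)"
    by (simp add: sum_distrib_left sum_distrib_right mult.assoc) (rule sum.swap)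
  also have "\<dots> = (\<Sum>l'\<in>S. Q i l' * pw k l' j)"
    using limit_point_right[OF assms(1,2)] by simp
  finally show ?case using Suc by simp
qed

lemma limit_point_left_pw:
  assumes "limit_point r Q" "i \<in> S" "j \<in> S"
  shows "(\<Sum>l\<in>S. pw k i l * Q l j) = Q i j"
  using assms(2)
proof (induction k arbitrary: i)
  case 0
  then show ?case using finS by (simp add: mult_delta)
next
  case (Suc k)
  have "(\<Sum>l\<in>S. pw (Suc k) i l * Q l j) = (\<Sum>l'\<in>S. P i l' * (\<Sum>l\<in>S. pw k l' l * Q l j))"
    by (simp add: sum_distrib_left sum_distrib_right mult.assoc) (rule sum.swap)
  also have "\<dots> = (\<Sum>l'\<in>S. P i l' * Q l' j)"
    using Suc.IH by simp
  finally show ?case using limit_point_left[OF assms(1) Suc.prems assms(3)] by simp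
qed

text \<open>Both limits equal the product \<open>Q Q'\<close>.\<close>

lemma limit_point_unique:
  assumes Q: "limit_point r Q" and Q': "limit_point r' Q'" and ij: "i \<in> S" "j \<in> S"
  shows "Q i j = Q' i j"
proof -
  have ces_left: "(\<Sum>l\<in>S. ces t i l * Q' l j) = Q' i j" if "t > 0" for t
  proof -
    have "(\<Sum>l\<in>S. (\<Sum>k<t. pw k i l) * Q' l j) = (\<Sum>k<t. \<Sum>l\<in>S. pw k i l * Q' l j)"
      by (simp add: sum_distrib_right) (rule sum.swap)
    also have "\<dots> = t * Q' i j" using limit_point_left_pw[OF Q' ij] by simp
    finally show ?thesis using that by (simp add: ces_def flip: sum_divide_distrib)
  qed
  have ces_right: "(\<Sum>l\<in>S. Q i l * ces t l j) = Q i j" if "t > 0" for t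
  proof -
    have "(\<Sum>l\<in>S. Q i l * (\<Sum>k<t. pw k l j)) = (\<Sum>k<t. \<Sum>l\<in>S. Q i l * pw k l j)"
      by (simp add: sum_distrib_left) (rule sum.swap)
    also have "\<dots> = t * Q i j" using limit_point_right_pw[OF Q ij] by simp
    finally show ?thesis using that by (simp add: ces_def flip: sum_divide_distrib)
  qed
  have "(\<lambda>t. \<Sum>l\<in>S. ces (r t) i l * Q' l j) \<longlonglongrightarrow> (\<Sum>l\<in>S. Q i l * Q' l j)"
    using limit_point_lim[OF Q ij(1)] by (intro tendsto_intros) auto
  moreover have "\<forall>\<^sub>F t in sequentially. (\<Sum>l\<in>S. ces (r t) i l * Q' l j) = Q' i j"
    using eventually_subseq_pos[OF limit_point_mono[OF Q]] by eventually_elim (rule ces_left)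
  ultimately have "(\<lambda>t. Q' i j) \<longlonglongrightarrow> (\<Sum>l\<in>S. Q i l * Q' l j)"
    by (rule Lim_transform_eventually)
  then have 1: "Q' i j = (\<Sum>l\<in>S. Q i l * Q' l j)" by (simp add: LIMSEQ_const_iff)
  have "(\<lambda>t. \<Sum>l\<in>S. Q i l * ces (r' t) l j) \<longlonglongrightarrow> (\<Sum>l\<in>S. Q i l * Q' l j)"
    using limit_point_lim[OF Q' _ ij(2)] by (intro tendsto_intros) auto
  moreover have "\<forall>\<^sub>F t in sequentially. (\<Sum>l\<in>S. Q i l * ces (r' t) l j) = Q i j"
    using eventually_subseq_pos[OF limit_point_mono[OF Q']] by eventually_elim (rule ces_right)
  ultimately have "(\<lambda>t. Q i j) \<longlonglongrightarrow> (\<Sum>l\<in>S. Q i l * Q' l j)"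
    by (rule Lim_transform_eventually)
  then show ?thesis using 1 by (simp add: LIMSEQ_const_iff)
qed

text \<open>Compactness gives a limit point inside every subsequence, and all limit points
  coincide.\<close>

lemma ex_ces_limit: "\<exists>Q. limit_point id Q"
proof -
  obtain r0 Q where Q: "limit_point r0 Q"
    using ex_limit_point[OF strict_mono_id] by blast
  have "(\<lambda>t. ces t i j) \<longlonglongrightarrow> Q i j" if ij: "i \<in> S" "j \<in> S" for i j
  proof (rule LIMSEQ_if_subseq_limits_unique)
    fix r :: "nat \<Rightarrow> nat" assume "strict_mono r"
    from ex_limit_point[OF this] obtain r' Q' where r': "strict_mono r'" "limit_point (r \<circ> r') Q'" by blast
    have "((\<lambda>t. ces t i j) \<circ> r \<circ> r') \<longlonglongrightarrow> Q' i j"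
      using limit_point_lim[OF r'(2) ij] by (simp add: o_def)
    moreover have "Q' i j = Q i j" using limit_point_unique[OF r'(2) Q ij] .
    ultimately show "\<exists>r'. strict_mono r' \<and> ((\<lambda>t. ces t i j) \<circ> r \<circ> r') \<longlonglongrightarrow> Q i j"
      using r'(1) by auto
  qed
  then have "limit_point id Q" by (simp add: limit_point_def strict_mono_id)
  then show ?thesis by blast
qed

definition cesaro_limit :: "'i \<Rightarrow> 'i \<Rightarrow> real" where
  "cesaro_limit = (SOME Q. limit_point id Q)"

lemma limit_point_cesaro: "limit_point id cesaro_limit"
  unfolding cesaro_limit_def using ex_ces_limit by (rule someI_ex)

lemma ces_lim: "i \<in> S \<Longrightarrow> j \<in> S \<Longrightarrow> (\<lambda>t. ces t i j) \<longlonglongrightarrow> cesaro_limit i j"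
  using limit_point_lim[OF limit_point_cesaro] by simp

lemma cesaro_limit_nonneg: "i \<in> S \<Longrightarrow> j \<in> S \<Longrightarrow> 0 \<le> cesaro_limit i j"
  by (rule LIMSEQ_le_const[OF ces_lim]) (auto intro: ces_nonneg)

lemma ces_sum: "i \<in> S \<Longrightarrow> t > 0 \<Longrightarrow> (\<Sum>j\<in>S. ces t i j) = 1"
proof -
  assume "i \<in> S" "t > 0"
  have "(\<Sum>j\<in>S. \<Sum>k<t. pw k i j) = (\<Sum>k<t. \<Sum>j\<in>S. pw k i j)" by (rule sum.swap)
  then show ?thesis using \<open>i \<in> S\<close> \<open>t > 0\<close> by (simp add: ces_def pw_sum flip: sum_divide_distrib)
qed

lemma cesaro_limit_sum: "i \<in> S \<Longrightarrow> (\<Sum>j\<in>S. cesaro_limit i j) = 1"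
proof -
  assume i: "i \<in> S"
  have "(\<lambda>t. \<Sum>j\<in>S. ces t i j) \<longlonglongrightarrow> (\<Sum>j\<in>S. cesaro_limit i j)"
    using i by (intro tendsto_intros ces_lim)
  moreover have "\<forall>\<^sub>F t in sequentially. (\<Sum>j\<in>S. ces t i j) = 1"
    using eventually_gt_at_top[of 0] by eventually_elim (rule ces_sum[OF i])
  ultimately have "(\<lambda>t. 1) \<longlonglongrightarrow> (\<Sum>j\<in>S. cesaro_limit i j)" by (rule Lim_transform_eventually)
  then show ?thesis by (simp add: LIMSEQ_const_iff)
qed

lemma cesaro_limit_pos_reach:
  assumes "i \<in> S" "j \<in> S" "cesaro_limit i j > 0"
  shows "\<exists>k. pw k i j > 0"
proof (rule ccontr)
  assume "\<nexists>k. pw k i j > 0"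
  then have "pw k i j = 0" for k using pw_nonneg[of k i j] by (metis less_eq_real_def)
  then have "ces t i j = 0" for t by (simp add: ces_def)
  then have "(\<lambda>t. 0) \<longlonglongrightarrow> cesaro_limit i j" using ces_lim[OF assms(1,2)] by simp
  then show False using assms(3) by (simp add: LIMSEQ_const_iff)
qed

section \<open>Mass and frequency for the uniform start\<close>

definition mass :: "nat \<Rightarrow> 'i \<Rightarrow> real" where
  "mass k j = (\<Sum>i\<in>S. pw k i j)"

text \<open>Normalised to total \<open>1\<close>, while \<open>mass k\<close> has total
  \<open>card S\<close>; this puts \<open>freq\<close> below \<open>mass 0\<close>, which is
  \<open>1\<close> on all of \<open>S\<close>. The Cesaro limit of \<open>mass\<close> itself is
  \<open>card S\<close> times \<open>freq\<close> and need not lie below it.\<close>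

definition freq :: "'i \<Rightarrow> real" where
  "freq j = (\<Sum>i\<in>S. cesaro_limit i j) / card S"

lemma cardS: "card S > 0"
  using finS neS by (simp add: card_gt_0_iff)

lemma mass_0: "j \<in> S \<Longrightarrow> mass 0 j = 1"
  using finS by (simp add: mass_def)

lemma mass_nonneg: "0 \<le> mass k j"
  by (auto simp: mass_def intro: sum_nonneg pw_nonneg)

lemma mass_Suc: "j \<in> S \<Longrightarrow> mass (Suc k) j = (\<Sum>i\<in>S. mass k i * P i j)"
proof -
  assume j: "j \<in> S"
  have "mass (Suc k) j = (\<Sum>i\<in>S. \<Sum>l\<in>S. pw k i l * P l j)"
    using j unfolding mass_def by (intro sum.cong refl pw_Suc_right)
  also have "\<dots> = (\<Sum>i\<in>S. mass k i * P i j)"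
    by (simp add: mass_def sum_distrib_right) (rule sum.swap)
  finally show ?thesis .
qed

lemma mass_sum: "(\<Sum>j\<in>S. mass k j) = card S"
proof -
  have "(\<Sum>j\<in>S. mass k j) = (\<Sum>i\<in>S. \<Sum>j\<in>S. pw k i j)" unfolding mass_def by (rule sum.swap)
  then show ?thesis by (simp add: pw_sum)
qed

lemma mass_le: "j \<in> S \<Longrightarrow> mass k j \<le> card S"
  using member_le_sum[of j S "mass k"] finS mass_nonneg mass_sum[of k] by auto

lemma freq_lim:
  assumes "j \<in> S"
  shows "(\<lambda>t. (\<Sum>k<t. mass k j / card S) / t) \<longlonglongrightarrow> freq j"
proof -
  have "(\<Sum>k<t. mass k j) = (\<Sum>i\<in>S. \<Sum>k<t. pw k i j)" for t
    by (simp add: mass_def) (rule sum.swap)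
  then have *: "(\<Sum>k<t. mass k j / card S) / t = (\<Sum>i\<in>S. ces t i j) / card S" for t
    by (simp add: ces_def flip: sum_divide_distrib)
  show ?thesis unfolding * freq_def using assms cardS by (intro tendsto_intros ces_lim) auto
qed

lemma freq_nonneg: "j \<in> S \<Longrightarrow> 0 \<le> freq j"
  by (auto simp: freq_def intro!: divide_nonneg_nonneg sum_nonneg cesaro_limit_nonneg)

lemma freq_sum: "(\<Sum>j\<in>S. freq j) = 1"
proof -
  have "(\<Sum>j\<in>S. \<Sum>i\<in>S. cesaro_limit i j) = (\<Sum>i\<in>S. \<Sum>j\<in>S. cesaro_limit i j)" by (rule sum.swap)
  then show ?thesis using cardS by (simp add: freq_def cesaro_limit_sum flip: sum_divide_distrib)
qed

lemma freq_le_1: "j \<in> S \<Longrightarrow> freq j \<le> 1"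
  using member_le_sum[of j S freq] finS freq_nonneg freq_sum by auto

lemma freq_invariant:
  assumes "j \<in> S"
  shows "(\<Sum>i\<in>S. freq i * P i j) = freq j"
proof -
  have "(\<Sum>i\<in>S. (\<Sum>l\<in>S. cesaro_limit l i) * P i j) = (\<Sum>l\<in>S. \<Sum>i\<in>S. cesaro_limit l i * P i j)"
    by (simp add: sum_distrib_right) (rule sum.swap)
  also have "\<dots> = (\<Sum>l\<in>S. cesaro_limit l j)"
    using assms limit_point_right[OF limit_point_cesaro] by simp
  finally show ?thesis by (simp add: freq_def flip: sum_divide_distrib)
qed

lemma freq_pos_closed:
  assumes "i \<in> S" "j \<in> S" "freq i > 0" "P i j > 0"
  shows "freq j > 0"
proof -
  have "0 < freq i * P i j" using assms by simp
  also have "\<dots> \<le> (\<Sum>i\<in>S. freq i * P i j)"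
    using assms finS by (intro member_le_sum) (auto intro!: mult_nonneg_nonneg freq_nonneg P_nonneg)
  finally show ?thesis using freq_invariant[OF assms(2)] by simp
qed

lemma freq_le_mass: "j \<in> S \<Longrightarrow> freq j \<le> mass k j"
proof (induction k arbitrary: j)
  case 0
  then show ?case by (simp add: mass_0 freq_le_1)
next
  case (Suc k)
  have "freq j = (\<Sum>i\<in>S. freq i * P i j)" using freq_invariant Suc.prems by simp
  also have "\<dots> \<le> (\<Sum>i\<in>S. mass k i * P i j)"
    using Suc by (intro sum_mono mult_right_mono P_nonneg) auto
  finally show ?case using mass_Suc[OF Suc.prems] by simp
qed

section \<open>First passage, recurrence and positive frequency\<close>

primrec fp :: "'i \<Rightarrow> nat \<Rightarrow> 'i \<Rightarrow> real" where
  "fp j 0 i = P i j"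
| "fp j (Suc t) i = (\<Sum>k\<in>S - {j}. P i k * fp j t k)"

lemma fp_nonneg: "0 \<le> fp j t i"
  by (induction t arbitrary: i) (auto intro!: sum_nonneg mult_nonneg_nonneg P_nonneg)

lemma fp_partial_sum:
  "(\<Sum>t<Suc T. fp j t i) = P i j + (\<Sum>k\<in>S - {j}. P i k * (\<Sum>t<T. fp j t k))"
proof -
  have "(\<Sum>t<T. fp j (Suc t) i) = (\<Sum>k\<in>S - {j}. P i k * (\<Sum>t<T. fp j t k))"
    by (simp add: sum_distrib_left) (rule sum.swap)
  then show ?thesis by (subst sum.lessThan_Suc_shift) simp
qed

lemma P_split: "i \<in> S \<Longrightarrow> j \<in> S \<Longrightarrow> P i j + (\<Sum>k\<in>S - {j}. P i k) = 1"
  using P_sum[of i] sum.remove[OF finS, of j "P i"] by simp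

lemma fp_sum_le_1: "i \<in> S \<Longrightarrow> j \<in> S \<Longrightarrow> (\<Sum>t<T. fp j t i) \<le> 1"
proof (induction T arbitrary: i)
  case 0
  then show ?case by simp
next
  case (Suc T)
  have "(\<Sum>k\<in>S - {j}. P i k * (\<Sum>t<T. fp j t k)) \<le> (\<Sum>k\<in>S - {j}. P i k * 1)"
    using Suc by (intro sum_mono mult_left_mono P_nonneg) auto
  then show ?case using P_split[of i j] Suc.prems unfolding fp_partial_sum by simp
qed

lemma fp_summable: "i \<in> S \<Longrightarrow> j \<in> S \<Longrightarrow> summable (\<lambda>t. fp j t i)"
  by (rule summableI_nonneg_bounded[of _ 1]) (auto intro: fp_nonneg fp_sum_le_1)

text \<open>The probability that the chain from \<open>i\<close> visits \<open>j\<close> at some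
  time at least \<open>1\<close>; thus \<open>hit j j\<close> is the return probability.\<close>

definition hit :: "'i \<Rightarrow> 'i \<Rightarrow> real" where
  "hit j i = (\<Sum>t. fp j t i)"

lemma hit_le_1: "i \<in> S \<Longrightarrow> j \<in> S \<Longrightarrow> hit j i \<le> 1"
  unfolding hit_def by (rule suminf_le_const) (auto intro: fp_summable fp_sum_le_1)

lemma hit_eq:
  assumes "i \<in> S" "j \<in> S"
  shows "hit j i = P i j + (\<Sum>k\<in>S - {j}. P i k * hit j k)"
proof (rule LIMSEQ_unique)
  show "(\<lambda>T. \<Sum>t<Suc T. fp j t i) \<longlonglongrightarrow> hit j i"
    unfolding hit_def by (rule LIMSEQ_Suc) (rule summable_LIMSEQ[OF fp_summable[OF assms]])
  show "(\<lambda>T. \<Sum>t<Suc T. fp j t i) \<longlonglongrightarrow> P i j + (\<Sum>k\<in>S - {j}. P i k * hit j k)"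
    unfolding fp_partial_sum hit_def using assms
    by (intro tendsto_intros summable_LIMSEQ fp_summable) auto
qed

text \<open>\<open>hit_eq\<close> writes \<open>hit j i\<close> as an average, with weights
  \<open>P i k\<close>, of numbers at most \<open>1\<close>; it equals \<open>1\<close> only if
  every number of positive weight does. The target \<open>j\<close> enters with value
  \<open>1\<close> instead of \<open>hit j j\<close>, hence the separate assumption on
  \<open>hit j j\<close>.\<close>

lemma hit_1_closed:
  assumes "i \<in> S" "j \<in> S" "k \<in> S" "hit j i = 1" "hit j j = 1" "P i k > 0"
  shows "hit j k = 1"
proof (rule ccontr)
  assume *: "hit j k \<noteq> 1"
  then have kj: "k \<noteq> j" and lt: "hit j k < 1" using assms hit_le_1[of k j] by auto
  have "(\<Sum>k\<in>S - {j}. P i k * hit j k) < (\<Sum>k\<in>S - {j}. P i k * 1)"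
  proof (rule sum_strict_mono_ex1)
    show "\<forall>k\<in>S - {j}. P i k * hit j k \<le> P i k * 1"
      using assms hit_le_1 by (auto intro!: mult_left_le P_nonneg)
    show "\<exists>k\<in>S - {j}. P i k * hit j k < P i k * 1"
      using kj lt assms by (intro bexI[of _ k] mult_strict_left_mono) auto
  qed (use finS in auto)
  then show False using hit_eq[OF assms(1,2)] P_split[OF assms(1,2)] assms(4) by simp
qed

lemma hit_1_reach:
  assumes "i \<in> S" "j \<in> S" "k \<in> S" "hit j i = 1" "hit j j = 1" "pw t i k > 0"
  shows "hit j k = 1"
  using assms(1,4,6)
proof (induction t arbitrary: i)
  case 0
  then show ?case by (auto split: if_splits)
next
  case (Suc t)
  have "\<exists>l\<in>S. P i l * pw t l k > 0"
  proof (rule ccontr)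
    assume "\<not> ?thesis"
    then have "(\<Sum>l\<in>S. P i l * pw t l k) \<le> 0" by (intro sum_nonpos) auto
    with Suc.prems show False by simp
  qed
  then obtain l where l: "l \<in> S" "P i l * pw t l k > 0" by blast
  then have Pl: "P i l > 0" and wl: "pw t l k > 0"
    using P_nonneg[of i l] pw_nonneg[of t l k] by (simp_all add: zero_less_mult_iff)
  show ?case using Suc.IH[OF l(1) _ wl] hit_1_closed[OF Suc.prems(1) assms(2) l(1) Suc.prems(2) assms(5) Pl] by blast
qed

lemma fp_le_pw: "i \<in> S \<Longrightarrow> j \<in> S \<Longrightarrow> fp j t i \<le> pw (Suc t) i j"
proof (induction t arbitrary: i)
  case 0
  then show ?case using finS by (simp add: mult_delta)
next
  case (Suc t)
  have "fp j (Suc t) i \<le> (\<Sum>k\<in>S - {j}. P i k * pw (Suc t) k j)"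
    unfolding fp.simps using Suc by (intro sum_mono mult_left_mono P_nonneg) auto
  also have "\<dots> \<le> (\<Sum>k\<in>S. P i k * pw (Suc t) k j)"
    using finS by (intro sum_mono2) (auto intro!: mult_nonneg_nonneg P_nonneg pw_nonneg simp del: pw.simps)
  finally show ?case by simp
qed

lemma hit_pos_reach:
  assumes "i \<in> S" "j \<in> S" "hit j i > 0"
  shows "\<exists>t. pw t i j > 0"
proof (rule ccontr)
  assume *: "\<nexists>t. pw t i j > 0"
  have "fp j t i \<le> 0" for t
    using fp_le_pw[OF assms(1,2), of t] * by (meson not_less order_trans)
  then have "fp j t i = 0" for t using fp_nonneg[of j t i] by (meson antisym)
  then show False using assms(3) by (simp add: hit_def)
qed

definition rec :: "'i \<Rightarrow> bool" where
  "rec j \<longleftrightarrow> (\<lambda>t. fp j t j) sums 1"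

lemma rec_iff_hit: "j \<in> S \<Longrightarrow> rec j \<longleftrightarrow> hit j j = 1"
  unfolding rec_def hit_def using fp_summable[of j j] by (auto simp: sums_iff)

text \<open>From \<open>j\<close>, some state \<open>c\<close> has a positive Cesaro limit. It is
  reachable from \<open>j\<close>, so by recurrence it leads back to \<open>j\<close>, and right
  invariance carries the positive weight from \<open>c\<close> to \<open>j\<close>.\<close>

lemma rec_imp_freq_pos:
  assumes j: "j \<in> S" and "rec j"
  shows "freq j > 0"
proof -
  have h: "hit j j = 1" using assms rec_iff_hit by simp
  have "\<exists>c\<in>S. cesaro_limit j c > 0"
  proof (rule ccontr)
    assume "\<not> ?thesis"
    then have "(\<Sum>c\<in>S. cesaro_limit j c) \<le> 0" by (intro sum_nonpos) auto
    then show False using cesaro_limit_sum[OF j] by simp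
  qed
  then obtain c where c: "c \<in> S" "cesaro_limit j c > 0" by blast
  obtain k where "pw k j c > 0" using cesaro_limit_pos_reach[OF j c] by blast
  then have "hit j c = 1" using hit_1_reach[OF j j c(1) h h] by simp
  then obtain s where s: "pw s c j > 0" using hit_pos_reach[OF c(1) j] by auto
  have "0 < cesaro_limit j c * pw s c j" using c s by simp
  also have "\<dots> \<le> (\<Sum>l\<in>S. cesaro_limit j l * pw s l j)"
    using finS c j by (intro member_le_sum) (auto intro!: mult_nonneg_nonneg cesaro_limit_nonneg pw_nonneg)
  also have "\<dots> = cesaro_limit j j" by (rule limit_point_right_pw[OF limit_point_cesaro j j])
  finally have "0 < cesaro_limit j j" .
  also have "\<dots> \<le> (\<Sum>i\<in>S. cesaro_limit i j)"
    using finS j by (intro member_le_sum) (auto intro!: cesaro_limit_nonneg)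
  finally show ?thesis using cardS by (simp add: freq_def)
qed

text \<open>Decomposition at the first visit, after which at most \<open>T\<close> times of a chain
  started in \<open>j\<close> remain to be counted. It is truncated because finiteness of the
  expected number of visits is what it will prove.\<close>

lemma visits_le_hit:
  assumes "i \<in> S" "j \<in> S"
  shows "(\<Sum>t<T. pw (Suc t) i j) \<le> (\<Sum>t<T. fp j t i) * (\<Sum>t<T. pw t j j)"
  using assms(1)
proof (induction T arbitrary: i)
  case 0
  then show ?case by simp
next
  case (Suc T)
  let ?U = "\<lambda>T. \<Sum>t<T. pw t j j"
  have U: "?U T \<le> ?U (Suc T)" using pw_nonneg[of T j j] by (simp only: sum.lessThan_Suc)
  have shift: "(\<Sum>t<Suc T. pw t k j) = (\<Sum>t<T. pw (Suc t) k j)" if "k \<in> S - {j}" for k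
    using that sum.lessThan_Suc_shift[of "\<lambda>t. pw t k j" T] by (simp only: pw.simps(1)) auto
  have le: "(\<Sum>k\<in>S - {j}. P i k * (\<Sum>t<T. pw (Suc t) k j)) \<le>
    (\<Sum>k\<in>S - {j}. P i k * ((\<Sum>t<T. fp j t k) * ?U (Suc T)))"
  proof (intro sum_mono mult_left_mono P_nonneg)
    fix k assume k: "k \<in> S - {j}"
    have "(\<Sum>t<T. pw (Suc t) k j) \<le> (\<Sum>t<T. fp j t k) * ?U T" using k by (intro Suc.IH) blast
    also have "\<dots> \<le> (\<Sum>t<T. fp j t k) * ?U (Suc T)"
      by (intro mult_left_mono U sum_nonneg fp_nonneg)
    finally show "(\<Sum>t<T. pw (Suc t) k j) \<le> (\<Sum>t<T. fp j t k) * ?U (Suc T)" .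
  qed
  have "(\<Sum>t<Suc T. pw (Suc t) i j) = (\<Sum>k\<in>S. P i k * (\<Sum>t<Suc T. pw t k j))"
    by (simp only: pw.simps sum_distrib_left) (rule sum.swap)
  also have "\<dots> = P i j * ?U (Suc T) + (\<Sum>k\<in>S - {j}. P i k * (\<Sum>t<Suc T. pw t k j))"
    by (rule sum.remove[OF finS assms(2)])
  also have "(\<Sum>k\<in>S - {j}. P i k * (\<Sum>t<Suc T. pw t k j)) = (\<Sum>k\<in>S - {j}. P i k * (\<Sum>t<T. pw (Suc t) k j))"
    using shift by (metis (no_types, lifting) sum.cong)
  also have "P i j * ?U (Suc T) + \<dots> \<le> P i j * ?U (Suc T) +
    (\<Sum>k\<in>S - {j}. P i k * ((\<Sum>t<T. fp j t k) * ?U (Suc T)))"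
    using le by (rule add_left_mono)
  also have "\<dots> = (\<Sum>t<Suc T. fp j t i) * ?U (Suc T)"
    unfolding fp_partial_sum distrib_right sum_distrib_right[of _ "S - {j}"] mult.assoc ..
  finally show ?case .
qed

text \<open>With return probability \<open>F < 1\<close>, the expected visits \<open>U\<close> up to
  a given time satisfy \<open>U <= 1 + F * U\<close>, hence \<open>U <= 1 / (1 - F)\<close>; another
  start raises the bound by at most one.\<close>

lemma not_rec_mass_summable:
  assumes j: "j \<in> S" and nr: "\<not> rec j"
  shows "summable (\<lambda>k. mass k j)"
proof -
  have F: "hit j j < 1" using nr rec_iff_hit[OF j] hit_le_1[OF j j] by simp
  have F0: "0 \<le> hit j j" unfolding hit_def by (rule suminf_nonneg[OF fp_summable[OF j j] fp_nonneg])
  let ?U = "\<lambda>T. \<Sum>t<T. pw t j j"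
  have U0: "0 \<le> ?U T" for T by (auto intro: sum_nonneg pw_nonneg)
  have shift: "(\<Sum>t<Suc T. pw t i j) = pw 0 i j + (\<Sum>t<T. pw (Suc t) i j)" for T i
    by (rule sum.lessThan_Suc_shift)
  have U: "?U T \<le> 1 / (1 - hit j j)" for T
  proof -
    have "?U T \<le> ?U (Suc T)" using pw_nonneg[of T j j] by simp
    also have "\<dots> \<le> 1 + (\<Sum>t<T. fp j t j) * ?U T"
      using visits_le_hit[OF j j, of T] pw_le_1[OF j j, of 0] unfolding shift by linarith
    also have "\<dots> \<le> 1 + hit j j * ?U T"
      unfolding hit_def
      by (intro add_left_mono mult_right_mono U0 sum_le_suminf fp_summable j fp_nonneg) simp
    finally have "?U T \<le> 1 + hit j j * ?U T" .
    then have "?U T * (1 - hit j j) \<le> 1" by (simp only: algebra_simps)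
    then show ?thesis using F by (simp add: pos_le_divide_eq)
  qed
  have "(\<Sum>k<T. pw k i j) \<le> 1 + 1 / (1 - hit j j)" if i: "i \<in> S" for i T
  proof -
    have "(\<Sum>k<T. pw k i j) \<le> (\<Sum>k<Suc T. pw k i j)" using pw_nonneg[of T i j] by simp
    also have "\<dots> \<le> 1 + (\<Sum>t<T. fp j t i) * ?U T"
      using visits_le_hit[OF i j, of T] pw_le_1[OF i j, of 0] unfolding shift by linarith
    also have "\<dots> \<le> 1 + 1 * (1 / (1 - hit j j))"
      by (intro add_left_mono mult_mono fp_sum_le_1 i j U U0) auto
    finally show ?thesis by simp
  qed
  then have "summable (\<lambda>k. pw k i j)" if "i \<in> S" for i
    using that by (intro summableI_nonneg_bounded[of _ "1 + 1 / (1 - hit j j)"] pw_nonneg)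
  then show ?thesis unfolding mass_def by (intro summable_sum)
qed

lemma freq_pos_imp_rec:
  assumes j: "j \<in> S" and pos: "freq j > 0"
  shows "rec j"
proof (rule ccontr)
  assume "\<not> rec j"
  then have s: "summable (\<lambda>k. mass k j / card S)"
    using not_rec_mass_summable[OF j] by (intro summable_divide)
  have "(\<lambda>t. (\<Sum>k<t. mass k j / card S) * (1 / t)) \<longlonglongrightarrow> (\<Sum>k. mass k j / card S) * 0"
    by (intro tendsto_mult summable_LIMSEQ s lim_1_over_n)
  then have "freq j = 0" using LIMSEQ_unique[OF freq_lim[OF j]] by simp
  then show False using pos by simp
qed

text \<open>Turns recurrence into a property of an invariant vector of total \<open>1\<close>, from
  which closedness and existence of recurrent states follow.\<close>

lemma rec_iff_freq_pos: "j \<in> S \<Longrightarrow> rec j \<longleftrightarrow> freq j > 0"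
  using rec_imp_freq_pos freq_pos_imp_rec by blast

lemma rec_closed: "i \<in> S \<Longrightarrow> j \<in> S \<Longrightarrow> rec i \<Longrightarrow> P i j > 0 \<Longrightarrow> rec j"
  using freq_pos_closed[of i j] rec_iff_freq_pos[of i] rec_iff_freq_pos[of j] by blast

lemma ex_rec: "\<exists>j\<in>S. rec j"
proof (rule ccontr)
  assume "\<not> ?thesis"
  then have "(\<Sum>j\<in>S. freq j) \<le> 0" using freq_pos_imp_rec by (intro sum_nonpos) force
  then show False using freq_sum by simp
qed

end

section \<open>Discounted visits\<close>

locale discounted_chain = finite_chain +
  fixes \<gamma> :: real
  assumes \<gamma>_pos: "0 < \<gamma>" and \<gamma>_less_1: "\<gamma> < 1"
begin

text \<open>The row vector \<open>1 (I - \<gamma> P)^-1\<close>, with \<open>1\<close> the all-ones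
  row, written as a Neumann series.\<close>

definition dmass :: "'a \<Rightarrow> real" where
  "dmass j = (\<Sum>k. \<gamma> ^ k * mass k j)"

lemma dmass_summable:
  assumes "j \<in> S"
  shows "summable (\<lambda>k. \<gamma> ^ k * mass k j)"
proof (rule summable_comparison_test')
  show "summable (\<lambda>k. \<gamma> ^ k * card S)"
    using \<gamma>_pos \<gamma>_less_1 by (intro summable_mult2 summable_geometric) auto
  show "norm (\<gamma> ^ k * mass k j) \<le> \<gamma> ^ k * card S" for k
    using \<gamma>_pos mass_nonneg[of k j] mass_le[OF assms, of k] by (simp add: abs_mult)
qed

lemma dmass_sums: "j \<in> S \<Longrightarrow> (\<lambda>k. \<gamma> ^ k * mass k j) sums dmass j"
  unfolding dmass_def by (intro summable_sums dmass_summable)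

lemma dmass_eq:
  assumes "j \<in> S"
  shows "dmass j = 1 + \<gamma> * (\<Sum>i\<in>S. dmass i * P i j)"
proof (rule sums_unique2)
  show "(\<lambda>k. \<gamma> ^ k * mass k j) sums dmass j" using assms by (rule dmass_sums)
  have "(\<lambda>k. \<gamma> * (\<Sum>i\<in>S. (\<gamma> ^ k * mass k i) * P i j)) sums (\<gamma> * (\<Sum>i\<in>S. dmass i * P i j))"
    by (intro sums_mult sums_sum sums_mult2 dmass_sums)
  also have "(\<lambda>k. \<gamma> * (\<Sum>i\<in>S. (\<gamma> ^ k * mass k i) * P i j)) = (\<lambda>k. \<gamma> ^ Suc k * mass (Suc k) j)"
    by (simp add: mass_Suc[OF assms] sum_distrib_left mult.assoc)
  finally have "(\<lambda>k. \<gamma> ^ k * mass k j) sums (\<gamma> * (\<Sum>i\<in>S. dmass i * P i j) + \<gamma> ^ 0 * mass 0 j)"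
    by (rule sums_Suc)
  then show "(\<lambda>k. \<gamma> ^ k * mass k j) sums (1 + \<gamma> * (\<Sum>i\<in>S. dmass i * P i j))"
    by (simp add: mass_0[OF assms] add.commute)
qed

lemma dmass_ge_1:
  assumes "j \<in> S"
  shows "1 \<le> dmass j"
proof -
  have "(\<Sum>k\<in>{0}. \<gamma> ^ k * mass k j) \<le> dmass j"
    unfolding dmass_def using \<gamma>_pos
    by (intro sum_le_suminf dmass_summable[OF assms]) (auto intro!: mult_nonneg_nonneg mass_nonneg)
  then show ?thesis by (simp add: mass_0[OF assms])
qed

text \<open>This is \<open>dmass_eq\<close>, read as \<open>x (I - \<gamma> P) = 1\<close> for a row
  vector \<open>x\<close>, tested against \<open>w\<close>. The sum identities for values are
  instances of it.\<close>

lemma dmass_adjoint: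
  "(\<Sum>i\<in>S. dmass i * (w i - \<gamma> * (\<Sum>j\<in>S. P i j * w j))) = (\<Sum>i\<in>S. w i)"
proof -
  have "(\<Sum>i\<in>S. dmass i * (\<gamma> * (\<Sum>j\<in>S. P i j * w j))) = (\<Sum>i\<in>S. \<Sum>j\<in>S. \<gamma> * (dmass i * P i j * w j))"
    by (simp add: sum_distrib_left mult_ac)
  also have "\<dots> = (\<Sum>j\<in>S. \<Sum>i\<in>S. \<gamma> * (dmass i * P i j * w j))" by (rule sum.swap)
  also have "\<dots> = (\<Sum>j\<in>S. \<gamma> * (\<Sum>i\<in>S. dmass i * P i j) * w j)"
    by (simp add: sum_distrib_left sum_distrib_right mult_ac)
  also have "\<dots> = (\<Sum>j\<in>S. (dmass j - 1) * w j)"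
    by (intro sum.cong refl) (simp add: dmass_eq)
  finally have "(\<Sum>i\<in>S. dmass i * (\<gamma> * (\<Sum>j\<in>S. P i j * w j))) = (\<Sum>j\<in>S. (dmass j - 1) * w j)" .
  then show ?thesis by (simp add: right_diff_distrib left_diff_distrib sum_subtractf)
qed

lemma dmass_sum: "(\<Sum>i\<in>S. dmass i) = card S / (1 - \<gamma>)"
proof -
  have "(\<Sum>i\<in>S. dmass i * (1 - \<gamma> * (\<Sum>j\<in>S. P i j * 1))) = card S"
    using dmass_adjoint[of "\<lambda>_. 1"] by simp
  then have "(\<Sum>i\<in>S. dmass i * (1 - \<gamma>)) = card S" by (simp add: P_sum)
  then have "(\<Sum>i\<in>S. dmass i) * (1 - \<gamma>) = card S" by (simp only: sum_distrib_right)
  then show ?thesis using \<gamma>_less_1 by (simp add: eq_divide_eq)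
qed

lemma dmass_le: "j \<in> S \<Longrightarrow> dmass j \<le> card S / (1 - \<gamma>)"
  unfolding dmass_sum[symmetric] using finS
  by (intro member_le_sum) (auto intro: order_trans[OF zero_le_one dmass_ge_1])

lemma freq_le_dmass:
  assumes "j \<in> S"
  shows "freq j / (1 - \<gamma>) \<le> dmass j"
proof (rule sums_le[OF _ _ dmass_sums[OF assms]])
  show "\<gamma> ^ k * freq j \<le> \<gamma> ^ k * mass k j" for k
    using \<gamma>_pos freq_le_mass[OF assms] by (intro mult_left_mono) auto
  show "(\<lambda>k. \<gamma> ^ k * freq j) sums (freq j / (1 - \<gamma>))"
    using sums_mult2[OF geometric_sums[of \<gamma>], of "freq j"] \<gamma>_pos \<gamma>_less_1 by simp
qed

lemma dmass_le_visits:
  assumes "j \<in> S" "\<not> rec j"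
  shows "dmass j \<le> (\<Sum>k. mass k j)"
  unfolding dmass_def
proof (rule suminf_le)
  show "\<gamma> ^ k * mass k j \<le> mass k j" for k
    using \<gamma>_pos \<gamma>_less_1 mass_nonneg[of k j] by (intro mult_left_le_one_le) (auto intro: power_le_one)
qed (use assms dmass_summable not_rec_mass_summable in auto)

text \<open>Minimum principle: at a minimiser \<open>m\<close> of \<open>w\<close> the average of
  \<open>w\<close> is at least \<open>w m\<close>, so \<open>\<gamma> * w m <= w m\<close>, which
  forces \<open>w m >= 0\<close>.\<close>

lemma discounted_pos:
  assumes w: "\<And>i. i \<in> S \<Longrightarrow> \<gamma> * (\<Sum>j\<in>S. P i j * w j) \<le> w i" and i: "i \<in> S"
  shows "0 \<le> (w i :: real)"
proof -
  obtain m where m: "m \<in> S" "\<And>j. j \<in> S \<Longrightarrow> w m \<le> w j"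
    using finS neS by (metis arg_min_if_finite(1) arg_min_least)
  have "w m = (\<Sum>j\<in>S. P m j * w m)" using P_sum[OF m(1)] by (simp flip: sum_distrib_right)
  also have "\<dots> \<le> (\<Sum>j\<in>S. P m j * w j)" by (intro sum_mono mult_left_mono m P_nonneg)
  finally have "\<gamma> * w m \<le> \<gamma> * (\<Sum>j\<in>S. P m j * w j)" using \<gamma>_pos by (intro mult_left_mono) auto
  also have "\<dots> \<le> w m" by (rule w[OF m(1)])
  finally have "0 \<le> (1 - \<gamma>) * w m" by (simp add: algebra_simps)
  then have "0 \<le> w m" using \<gamma>_less_1 by (simp add: zero_le_mult_iff)
  then show ?thesis using m(2)[OF i] by simp
qed

lemma discounted_eq_0:
  assumes "\<And>i. i \<in> S \<Longrightarrow> w i = \<gamma> * (\<Sum>j\<in>S. P i j * w j)" "i \<in> S"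
  shows "w i = (0 :: real)"
proof -
  have "0 \<le> w i" by (rule discounted_pos) (use assms in auto)
  moreover have "0 \<le> - w i"
    by (rule discounted_pos[where w = "\<lambda>i. - w i"]) (use assms in \<open>auto simp: sum_negf\<close>)
  ultimately show ?thesis by simp
qed

lemma ex_discounted_solution:
  shows "\<exists>v :: 'a \<Rightarrow> real. \<forall>i\<in>S. v i = r i + \<gamma> * (\<Sum>j\<in>S. P i j * v j)"
proof -
  \<comment> \<open>\<open>u k\<close> is \<open>P^k r\<close>; the solution is the Neumann series
    with these terms.\<close>
  define u where "u k i = (\<Sum>j\<in>S. pw k i j * r j)" for k i
  have summ: "summable (\<lambda>k. \<gamma> ^ k * u k i)" if "i \<in> S" for i
  proof (rule summable_comparison_test')
    show "summable (\<lambda>k. \<gamma> ^ k * (\<Sum>j\<in>S. \<bar>r j\<bar>))"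
      using \<gamma>_pos \<gamma>_less_1 by (intro summable_mult2 summable_geometric) auto
    show "norm (\<gamma> ^ k * u k i) \<le> \<gamma> ^ k * (\<Sum>j\<in>S. \<bar>r j\<bar>)" for k
    proof -
      have "\<bar>u k i\<bar> \<le> (\<Sum>j\<in>S. \<bar>pw k i j * r j\<bar>)" unfolding u_def by (rule sum_abs)
      also have "\<dots> \<le> (\<Sum>j\<in>S. \<bar>r j\<bar>)"
        using pw_le_1[OF that] pw_nonneg
        by (intro sum_mono) (auto simp: abs_mult intro!: mult_left_le_one_le)
      finally show ?thesis using \<gamma>_pos by (simp add: abs_mult)
    qed
  qed
  define v where "v i = (\<Sum>k. \<gamma> ^ k * u k i)" for i
  have "v i = r i + \<gamma> * (\<Sum>j\<in>S. P i j * v j)" if i: "i \<in> S" for i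
  proof (rule sums_unique2)
    show "(\<lambda>k. \<gamma> ^ k * u k i) sums v i" unfolding v_def by (rule summable_sums[OF summ[OF i]])
    have uSuc: "u (Suc k) i = (\<Sum>l\<in>S. P i l * u k l)" for k
      unfolding u_def by (simp add: sum_distrib_left sum_distrib_right mult.assoc) (rule sum.swap)
    have u0: "u 0 i = r i" unfolding u_def using finS i by (simp add: mult_delta)
    have "(\<lambda>k. \<gamma> * (\<Sum>j\<in>S. P i j * (\<gamma> ^ k * u k j))) sums (\<gamma> * (\<Sum>j\<in>S. P i j * v j))"
      unfolding v_def by (intro sums_mult sums_sum summable_sums summ)
    also have "(\<lambda>k. \<gamma> * (\<Sum>j\<in>S. P i j * (\<gamma> ^ k * u k j))) = (\<lambda>k. \<gamma> ^ Suc k * u (Suc k) i)"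
      by (simp add: uSuc sum_distrib_left mult_ac)
    finally have "(\<lambda>k. \<gamma> ^ k * u k i) sums (\<gamma> * (\<Sum>j\<in>S. P i j * v j) + \<gamma> ^ 0 * u 0 i)"
      by (rule sums_Suc)
    then show "(\<lambda>k. \<gamma> ^ k * u k i) sums (r i + \<gamma> * (\<Sum>j\<in>S. P i j * v j))"
      by (simp add: u0 add.commute)
  qed
  then show ?thesis by blast
qed

text \<open>
  Before absorption into the recurrent states the chain accumulates at most \<open>dmass\<close> times the
  one-step gains \<open>d\<close>, and afterwards it contributes at most \<open>b\<close>.
\<close>

lemma sum_le_transient_part:
  fixes b :: real
  assumes w: "\<And>i. i \<in> S \<Longrightarrow> w i = d i + \<gamma> * (\<Sum>j\<in>S. P i j * w j)"
    and b: "\<And>i. i \<in> S \<Longrightarrow> rec i \<Longrightarrow> w i \<le> b" and "0 \<le> b"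
  shows "(\<Sum>i\<in>S. w i) \<le> card S * b + (\<Sum>i\<in>{i\<in>S. \<not> rec i}. dmass i * d i)"
proof -
  \<comment> \<open>After subtracting \<open>b\<close> the recurrent values are nonpositive, so
    setting them to \<open>0\<close> can only raise averages. Recurrent states lead only to
    recurrent states, hence \<open>u - \<gamma> P u\<close> vanishes on them and
    \<open>dmass_adjoint\<close> leaves the transient terms.\<close>
  define u where "u i = (if rec i then 0 else w i - b)" for i
  have "(\<Sum>i\<in>S. w i) \<le> (\<Sum>i\<in>S. u i + b)"
    using b by (intro sum_mono) (auto simp: u_def)
  also have "\<dots> = card S * b + (\<Sum>i\<in>S. u i)" by (simp add: sum.distrib)
  also have "(\<Sum>i\<in>S. u i) = (\<Sum>i\<in>S. dmass i * (u i - \<gamma> * (\<Sum>j\<in>S. P i j * u j)))"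
    by (rule dmass_adjoint[symmetric])
  also have "\<dots> \<le> (\<Sum>i\<in>S. if \<not> rec i then dmass i * d i else 0)"
  proof (rule sum_mono)
    fix i assume i: "i \<in> S"
    have x: "0 \<le> dmass i" using dmass_ge_1[OF i] by simp
    show "dmass i * (u i - \<gamma> * (\<Sum>j\<in>S. P i j * u j)) \<le> (if \<not> rec i then dmass i * d i else 0)"
    proof (cases "rec i")
      case True
      have "P i j * u j = 0" if "j \<in> S" for j
        using rec_closed[OF i that True] P_nonneg[of i j] by (auto simp: u_def less_le)
      then have "(\<Sum>j\<in>S. P i j * u j) = 0" by (rule sum.neutral[rule_format])
      then show ?thesis using True by (simp add: u_def)
    next
      case False
      have "(\<Sum>j\<in>S. P i j * w j) - b = (\<Sum>j\<in>S. P i j * (w j - b))"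
        by (simp add: right_diff_distrib sum_subtractf P_sum[OF i] flip: sum_distrib_right)
      also have "\<dots> \<le> (\<Sum>j\<in>S. P i j * u j)"
        using b by (intro sum_mono mult_left_mono P_nonneg) (auto simp: u_def)
      finally have "\<gamma> * ((\<Sum>j\<in>S. P i j * w j) - b) \<le> \<gamma> * (\<Sum>j\<in>S. P i j * u j)"
        using \<gamma>_pos by (intro mult_left_mono) auto
      moreover have "\<gamma> * b \<le> b" using \<open>0 \<le> b\<close> \<gamma>_pos \<gamma>_less_1 by (intro mult_left_le_one_le) auto
      ultimately have "u i - \<gamma> * (\<Sum>j\<in>S. P i j * u j) \<le> d i"
        using w[OF i] False by (simp add: u_def algebra_simps)
      then show ?thesis using False x by (simp add: mult_left_mono)
    qed
  qed
  also have "\<dots> = (\<Sum>i\<in>{i\<in>S. \<not> rec i}. dmass i * d i)"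
    using finS by (simp add: sum.If_cases Int_def)
  finally show ?thesis by simp
qed

end

section \<open>Policies and their values\<close>

locale fin_mdp =
  fixes M :: "'a mdp"
  assumes finite_mdp: "finite_mdp M"
begin

abbreviation "X \<equiv> states M"
abbreviation "n \<equiv> num_states M"
abbreviation "m \<equiv> num_actions M"
abbreviation "\<gamma> \<equiv> discount M"
abbreviation "V \<equiv> val M"

text \<open>The value of playing \<open>a\<close> once and collecting \<open>v\<close> afterwards;
  it takes an action, not a policy, so that all actions of a state can be compared.\<close>

definition qval :: "(nat \<Rightarrow> real) \<Rightarrow> nat \<Rightarrow> 'a \<Rightarrow> real" where
  "qval v i a = (\<Sum>j\<in>X. pmf (kernel M i a) j * reward M i a j) + \<gamma> * (\<Sum>j\<in>X. pmf (kernel M i a) j * v j)"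

definition visits :: "(nat \<Rightarrow> 'a) \<Rightarrow> nat \<Rightarrow> real" where
  "visits \<pi> = discounted_chain.dmass X (trans_prob M \<pi>) \<gamma>"

lemma n_pos: "0 < n" and discount: "0 < \<gamma>" "\<gamma> < 1"
  using finite_mdp by (auto simp: finite_mdp_def)

lemma finite_states [simp]: "finite X" and states_nonempty: "X \<noteq> {}" and card_states [simp]: "card X = n"
  using n_pos by (auto simp: states_def)

lemma finite_actions: "i \<in> X \<Longrightarrow> finite (actions M i)"
  using finite_mdp by (auto simp: finite_mdp_def all_actions_def)

lemma policiesD: "\<pi> \<in> policies M \<Longrightarrow> i \<in> X \<Longrightarrow> \<pi> i \<in> actions M i"
  by (auto simp: policies_def)

lemma finite_policies: "finite (policies M)"
  unfolding policies_def by (intro finite_PiE finite_actions) auto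

lemma policies_nonempty: "policies M \<noteq> {}"
  using finite_mdp by (auto simp: finite_mdp_def policies_def PiE_eq_empty_iff)

lemma policies_upd: "\<pi> \<in> policies M \<Longrightarrow> i \<in> X \<Longrightarrow> a \<in> actions M i \<Longrightarrow> \<pi>(i := a) \<in> policies M"
  by (auto simp: policies_def PiE_iff extensional_def)

lemma set_kernel: "i \<in> X \<Longrightarrow> a \<in> actions M i \<Longrightarrow> set_pmf (kernel M i a) \<subseteq> X"
  using finite_mdp by (auto simp: finite_mdp_def)

lemma chain:
  assumes "\<pi> \<in> policies M"
  shows "discounted_chain X (trans_prob M \<pi>) \<gamma>"
proof
  show "(\<Sum>j\<in>X. trans_prob M \<pi> i j) = 1" if "i \<in> X" for i
    unfolding trans_prob_def using set_kernel[OF that policiesD[OF assms that]]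
    by (intro sum_pmf_eq_1) auto
qed (use states_nonempty discount in \<open>auto simp: trans_prob_def\<close>)

lemma fchain: "\<pi> \<in> policies M \<Longrightarrow> finite_chain X (trans_prob M \<pi>)"
  using chain by (simp add: discounted_chain_def)

lemma bellman_pol_qval: "i \<in> X \<Longrightarrow> bellman_pol M \<pi> v i = qval v i (\<pi> i)"
  by (simp add: bellman_pol_def qval_def policy_reward_def trans_prob_def)

lemma qval_diff:
  "qval v i (\<pi> i) - qval w i (\<pi> i) = \<gamma> * (\<Sum>j\<in>X. trans_prob M \<pi> i j * (v j - w j))"
  by (simp add: qval_def trans_prob_def right_diff_distrib sum_subtractf)

lemma qval_mono: "(\<And>j. j \<in> X \<Longrightarrow> v j \<le> w j) \<Longrightarrow> qval v i a \<le> qval w i a"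
  unfolding qval_def using discount by (intro add_left_mono mult_left_mono sum_mono) auto

lemma val_fixed:
  assumes \<pi>: "\<pi> \<in> policies M"
  shows "bellman_pol M \<pi> (V \<pi>) = V \<pi>"
  unfolding val_def
proof (rule theI'[where P = "\<lambda>v. bellman_pol M \<pi> v = v"])
  interpret discounted_chain X "trans_prob M \<pi>" \<gamma> using \<pi> by (rule chain)
  obtain v where v: "\<And>i. i \<in> X \<Longrightarrow>
      v i = policy_reward M \<pi> i + \<gamma> * (\<Sum>j\<in>X. trans_prob M \<pi> i j * v j)"
    using ex_discounted_solution[of "policy_reward M \<pi>"] by blast
  \<comment> \<open>\<open>bellman_pol\<close> returns functions that are \<open>undefined\<close>
    outside \<open>X\<close>, so only the restricted solution can be a fixed point.\<close>
  define v' where "v' = restrict v X"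
  have "bellman_pol M \<pi> v' = v'"
    by (rule ext) (simp add: bellman_pol_def v'_def v[symmetric])
  moreover have "w = v'" if w: "bellman_pol M \<pi> w = w" for w
  proof
    fix i
    show "w i = v' i"
    proof (cases "i \<in> X")
      case True
      have fixp: "u i = qval u i (\<pi> i)" if "bellman_pol M \<pi> u = u" "i \<in> X" for u i
        using bellman_pol_qval[OF that(2), of \<pi> u] that(1) by simp
      have "w i - v' i = 0"
      proof (rule discounted_eq_0[where w = "\<lambda>i. w i - v' i", OF _ True])
        show "w i - v' i = \<gamma> * (\<Sum>j\<in>X. trans_prob M \<pi> i j * (w j - v' j))" if "i \<in> X" for i
          unfolding qval_diff[symmetric] fixp[OF w that, symmetric]
            fixp[OF \<open>bellman_pol M \<pi> v' = v'\<close> that, symmetric] ..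
      qed
      then show ?thesis by simp
    next
      case False
      then show ?thesis using arg_cong[OF w, of "\<lambda>f. f i"] by (simp add: bellman_pol_def v'_def)
    qed
  qed
  ultimately show "\<exists>!v. bellman_pol M \<pi> v = v" by blast
qed

lemma val_qval: "\<pi> \<in> policies M \<Longrightarrow> i \<in> X \<Longrightarrow> qval (V \<pi>) i (\<pi> i) = V \<pi> i"
  using val_fixed[of \<pi>] bellman_pol_qval[of i \<pi> "V \<pi>"] by simp

lemma val_extensional:
  assumes "\<pi> \<in> policies M"
  shows "V \<pi> \<in> extensional X"
proof -
  have "bellman_pol M \<pi> (V \<pi>) \<in> extensional X" by (simp add: bellman_pol_def)
  then show ?thesis by (simp only: val_fixed[OF assms])
qed

lemma val_sub_solution:
  assumes \<pi>: "\<pi> \<in> policies M" and v: "\<And>i. i \<in> X \<Longrightarrow> v i \<le> qval v i (\<pi> i)" and i: "i \<in> X"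
  shows "v i \<le> V \<pi> i"
proof -
  interpret discounted_chain X "trans_prob M \<pi>" \<gamma> using \<pi> by (rule chain)
  have "0 \<le> V \<pi> i - v i"
  proof (rule discounted_pos[where w = "\<lambda>i. V \<pi> i - v i", OF _ i])
    fix i assume i: "i \<in> X"
    show "\<gamma> * (\<Sum>j\<in>X. trans_prob M \<pi> i j * (V \<pi> j - v j)) \<le> V \<pi> i - v i"
      using qval_diff[of "V \<pi>" i \<pi> v] val_qval[OF \<pi> i] v[OF i] by simp
  qed
  then show ?thesis by simp
qed

lemma val_super_solution:
  assumes \<pi>: "\<pi> \<in> policies M" and v: "\<And>i. i \<in> X \<Longrightarrow> qval v i (\<pi> i) \<le> v i" and i: "i \<in> X"
  shows "V \<pi> i \<le> v i"
proof -
  interpret discounted_chain X "trans_prob M \<pi>" \<gamma> using \<pi> by (rule chain)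
  have "0 \<le> v i - V \<pi> i"
  proof (rule discounted_pos[where w = "\<lambda>i. v i - V \<pi> i", OF _ i])
    fix i assume i: "i \<in> X"
    show "\<gamma> * (\<Sum>j\<in>X. trans_prob M \<pi> i j * (v j - V \<pi> j)) \<le> v i - V \<pi> i"
      using qval_diff[of v i \<pi> "V \<pi>"] val_qval[OF \<pi> i] v[OF i] by simp
  qed
  then show ?thesis by simp
qed

text \<open>\<open>dmass_adjoint\<close> for \<open>w = V \<pi> - v\<close>, where
  \<open>w - \<gamma> P w\<close> is the one-step advantage of \<open>\<pi>\<close> over
  \<open>v\<close>.\<close>

lemma performance_difference:
  assumes \<pi>: "\<pi> \<in> policies M"
  shows "(\<Sum>i\<in>X. V \<pi> i - v i) = (\<Sum>i\<in>X. visits \<pi> i * (qval v i (\<pi> i) - v i))"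
proof -
  interpret discounted_chain X "trans_prob M \<pi>" \<gamma> using \<pi> by (rule chain)
  have "(\<Sum>i\<in>X. V \<pi> i - v i) = (\<Sum>i\<in>X. visits \<pi> i *
      ((V \<pi> i - v i) - \<gamma> * (\<Sum>j\<in>X. trans_prob M \<pi> i j * (V \<pi> j - v j))))"
    unfolding visits_def by (rule dmass_adjoint[symmetric])
  also have "\<dots> = (\<Sum>i\<in>X. visits \<pi> i * (qval v i (\<pi> i) - v i))"
    by (intro sum.cong refl) (simp add: qval_diff[symmetric] val_qval[OF \<pi>])
  finally show ?thesis .
qed

lemma visits_ge_1: "\<pi> \<in> policies M \<Longrightarrow> i \<in> X \<Longrightarrow> 1 \<le> visits \<pi> i"
  unfolding visits_def by (rule discounted_chain.dmass_ge_1[OF chain])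

lemma visits_sum: "\<pi> \<in> policies M \<Longrightarrow> (\<Sum>i\<in>X. visits \<pi> i) = n / (1 - \<gamma>)"
  unfolding visits_def by (subst discounted_chain.dmass_sum[OF chain]) simp_all

lemma visits_le: "\<pi> \<in> policies M \<Longrightarrow> i \<in> X \<Longrightarrow> visits \<pi> i \<le> n / (1 - \<gamma>)"
  unfolding visits_def using discounted_chain.dmass_le[OF chain] by fastforce

section \<open>The structural constants as bounds on visits\<close>

lemma first_passage_fp:
  assumes "\<pi> \<in> policies M"
  shows "first_passage M \<pi> j t i = finite_chain.fp X (trans_prob M \<pi>) j t i"
proof -
  interpret finite_chain X "trans_prob M \<pi>" using assms by (rule fchain)
  show ?thesis by (induction t arbitrary: i) simp_all
qed

lemma recurrent_rec:
  assumes "\<pi> \<in> policies M"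
  shows "recurrent M \<pi> j \<longleftrightarrow> finite_chain.rec X (trans_prob M \<pi>) j"
  unfolding recurrent_def first_passage_fp[OF assms] finite_chain.rec_def[OF fchain[OF assms]] ..

lemma recurrent_closed:
  assumes "\<pi> \<in> policies M" "i \<in> X" "j \<in> X" "recurrent M \<pi> i" "trans_prob M \<pi> i j > 0"
  shows "recurrent M \<pi> j"
  using finite_chain.rec_closed[OF fchain[OF assms(1)] assms(2,3) _ assms(5)] assms(4)
  by (simp only: recurrent_rec[OF assms(1)])

lemma ex_recurrent: "\<pi> \<in> policies M \<Longrightarrow> \<exists>j\<in>X. recurrent M \<pi> j"
  using finite_chain.ex_rec[OF fchain, of \<pi>] recurrent_rec[of \<pi>] by blast

text \<open>The support inclusion belongs to the induction because it reduces the integral in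
  \<open>pmf_bind\<close> to a sum over \<open>X\<close>.\<close>

lemma state_law_mass:
  assumes \<pi>: "\<pi> \<in> policies M"
  shows "set_pmf (state_law M \<pi> k) \<subseteq> X \<and>
    (\<forall>j\<in>X. pmf (state_law M \<pi> k) j = finite_chain.mass X (trans_prob M \<pi>) k j / n)"
proof (induction k)
  interpret finite_chain X "trans_prob M \<pi>" using \<pi> by (rule fchain)
  {
    case 0
    then show ?case using states_nonempty by (simp add: mass_0)
  next
    case (Suc k)
    have "pmf (state_law M \<pi> (Suc k)) j = mass (Suc k) j / n" if j: "j \<in> X" for j
    proof -
      have "pmf (state_law M \<pi> (Suc k)) j = (\<Sum>i\<in>X. trans_prob M \<pi> i j * pmf (state_law M \<pi> k) i)"
        unfolding state_law.simps pmf_bind trans_prob_def using Suc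
        by (intro integral_measure_pmf_real) auto
      also have "\<dots> = mass (Suc k) j / n"
        using Suc by (simp add: mass_Suc[OF j] sum_divide_distrib mult.commute)
      finally show ?thesis .
    qed
    moreover have "set_pmf (state_law M \<pi> (Suc k)) \<subseteq> X"
      using Suc set_kernel[OF _ policiesD[OF \<pi>]] by auto
    ultimately show ?case by blast
  }
qed

lemma occupation_mass:
  assumes "\<pi> \<in> policies M" "j \<in> X"
  shows "occupation M \<pi> j t = (\<Sum>k<t. finite_chain.mass X (trans_prob M \<pi>) k j / n)"
  unfolding occupation_def using state_law_mass[OF assms(1)] assms(2) by (intro sum.cong refl) blast

lemma frequency_freq:
  assumes "\<pi> \<in> policies M" "j \<in> X"
  shows "frequency M \<pi> j = finite_chain.freq X (trans_prob M \<pi>) j"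
  unfolding frequency_def occupation_mass[OF assms]
  using finite_chain.freq_lim[OF fchain[OF assms(1)] assms(2)] by (intro limI) simp

lemma recurrent_visits:
  assumes \<pi>: "\<pi> \<in> policies M" "j \<in> X" and r: "recurrent M \<pi> j" and c: "recurrent_bound M c"
  shows "1 \<le> c" "1 / ((1 - \<gamma>) * c) \<le> visits \<pi> j"
proof -
  interpret discounted_chain X "trans_prob M \<pi>" \<gamma> using \<pi>(1) by (rule chain)
  have f: "0 < freq j" using r \<pi> by (simp add: recurrent_rec rec_iff_freq_pos)
  have le: "1 / freq j \<le> c"
    using c \<pi> r unfolding frequency_freq[OF \<pi>, symmetric] recurrent_bound_def by blast
  moreover have "1 \<le> 1 / freq j" using f freq_le_1[OF \<pi>(2)] by simp
  ultimately show c1: "1 \<le> c" by simp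
  have "1 \<le> c * freq j" using le f by (simp add: pos_divide_le_eq)
  then have "1 / c \<le> freq j" using c1 by (simp add: pos_divide_le_eq mult.commute)
  then have "1 / c / (1 - \<gamma>) \<le> freq j / (1 - \<gamma>)"
    using discount by (intro divide_right_mono) auto
  also have "\<dots> \<le> visits \<pi> j" unfolding visits_def by (rule freq_le_dmass[OF \<pi>(2)])
  finally show "1 / ((1 - \<gamma>) * c) \<le> visits \<pi> j" by (simp add: mult.commute)
qed

lemma transient_visits:
  assumes \<pi>: "\<pi> \<in> policies M" "j \<in> X" and t: "\<not> recurrent M \<pi> j" and c: "transient_bound M (c :: real)"
  shows "visits \<pi> j \<le> real n * c"
proof -
  interpret discounted_chain X "trans_prob M \<pi>" \<gamma> using \<pi>(1) by (rule chain)
  have nr: "\<not> rec j" using t \<pi> by (simp add: recurrent_rec)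
  note s = not_rec_mass_summable[OF \<pi>(2) nr]
  have "occupation M \<pi> j \<longlonglongrightarrow> (\<Sum>k. mass k j / n)"
    unfolding occupation_mass[OF \<pi>, abs_def] by (intro summable_LIMSEQ summable_divide s)
  then have "lim (occupation M \<pi> j) = (\<Sum>k. mass k j) / n"
    by (simp add: limI suminf_divide s)
  moreover have "lim (occupation M \<pi> j) \<le> c"
    using c \<pi> t by (auto simp: transient_bound_def transient_def)
  ultimately have "(\<Sum>k. mass k j) / n \<le> c" by simp
  then have "(\<Sum>k. mass k j) \<le> n * c" using n_pos by (simp add: pos_divide_le_eq mult.commute)
  then show ?thesis using dmass_le_visits[OF \<pi>(2) nr] by (simp add: visits_def)
qed

text \<open>A transient state has at least one visit, so \<open>1 <= n * c\<close>. A recurrent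
  state exists as well, hence \<open>n >= 2\<close>, which makes the inequality strict.\<close>

lemma transient_bound_ge:
  assumes \<pi>: "\<pi> \<in> policies M" "j \<in> X" and t: "transient M \<pi> j" and c: "transient_bound M (c :: real)"
  shows "1 < real n ^ 2 * c"
proof -
  have tr: "\<not> recurrent M \<pi> j" using t by (simp add: transient_def)
  have 1: "1 \<le> n * c"
    using visits_ge_1[OF \<pi>] transient_visits[OF \<pi> tr c] by simp
  obtain i where "i \<in> X" "i \<noteq> j" using ex_recurrent[OF \<pi>(1)] tr by blast
  then have "card {i, j} \<le> card X" using \<pi> by (intro card_mono) auto
  then have n: "1 < n" using \<open>i \<noteq> j\<close> by simp
  have "1 * 1 < real n * (n * c)" using 1 n by (intro mult_less_le_imp_less) auto
  then show "1 < real n ^ 2 * c" by (simp add: power2_eq_square mult.assoc)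
qed

lemma val_eq_on_closed:
  assumes \<pi>: "\<pi> \<in> policies M" "\<pi>' \<in> policies M" and T: "T \<subseteq> X"
    and closed: "\<And>i j. i \<in> T \<Longrightarrow> j \<in> X \<Longrightarrow> trans_prob M \<pi> i j > 0 \<Longrightarrow> j \<in> T"
    and eq: "\<And>i. i \<in> T \<Longrightarrow> \<pi> i = \<pi>' i" and i: "i \<in> T"
  shows "V \<pi> i = V \<pi>' i"
proof -
  interpret discounted_chain X "trans_prob M \<pi>" \<gamma> using \<pi>(1) by (rule chain)
  \<comment> \<open>On \<open>T\<close> both values solve the same equations, so the modulus of
    their difference is at most \<open>\<gamma>\<close> times its average. Minus this modulus, cut
    off outside the closed set \<open>T\<close>, fits \<open>discounted_pos\<close> and is therefore
    also nonnegative.\<close>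
  define w where "w i = (if i \<in> T then - \<bar>V \<pi> i - V \<pi>' i\<bar> else 0)" for i
  have "0 \<le> w i"
  proof (rule discounted_pos)
    fix i assume i: "i \<in> X"
    show "\<gamma> * (\<Sum>j\<in>X. trans_prob M \<pi> i j * w j) \<le> w i"
    proof (cases "i \<in> T")
      case True
      have "\<bar>V \<pi> i - V \<pi>' i\<bar> = \<bar>\<gamma> * (\<Sum>j\<in>X. trans_prob M \<pi> i j * (V \<pi> j - V \<pi>' j))\<bar>"
        using qval_diff[of "V \<pi>" i \<pi> "V \<pi>'"] val_qval[OF \<pi>(1) i] val_qval[OF \<pi>(2) i] eq[OF True]
        by simp
      also have "\<dots> \<le> \<gamma> * (\<Sum>j\<in>X. \<bar>trans_prob M \<pi> i j * (V \<pi> j - V \<pi>' j)\<bar>)"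
        unfolding abs_mult using discount by (auto intro: order_trans[OF sum_abs] simp: abs_mult)
      also have "(\<Sum>j\<in>X. \<bar>trans_prob M \<pi> i j * (V \<pi> j - V \<pi>' j)\<bar>) = - (\<Sum>j\<in>X. trans_prob M \<pi> i j * w j)"
      proof -
        have "\<bar>trans_prob M \<pi> i j * (V \<pi> j - V \<pi>' j)\<bar> = - (trans_prob M \<pi> i j * w j)" if "j \<in> X" for j
        proof (cases "trans_prob M \<pi> i j = 0")
          case False
          then have "trans_prob M \<pi> i j > 0" using P_nonneg[of i j] by simp
          then show ?thesis using closed[OF True that] by (simp add: w_def abs_mult)
        qed simp
        then show ?thesis by (simp add: sum_negf)
      qed
      finally show ?thesis using True by (simp add: w_def)
    next
      case False
      have "(\<Sum>j\<in>X. trans_prob M \<pi> i j * w j) \<le> 0"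
        by (intro sum_nonpos mult_nonneg_nonpos P_nonneg) (simp add: w_def)
      then show ?thesis using False discount by (simp add: w_def mult_nonneg_nonpos)
    qed
  qed (use T i in auto)
  then show ?thesis using i by (simp add: w_def)
qed

text \<open>
  The recurrent classes of the new policy avoid the switched state, so none of them is new.
\<close>

lemma recurrent_switch_transient:
  assumes \<pi>: "\<pi> \<in> policies M" "\<pi>' \<in> policies M" and eq: "\<And>j. j \<noteq> i \<Longrightarrow> \<pi>' j = \<pi> j"
    and i: "\<not> recurrent M \<pi>' i" and j: "j \<in> X" "recurrent M \<pi>' j"
  shows "recurrent M \<pi> j" "\<pi> j = \<pi>' j"
proof -
  have neq: "k \<noteq> i" if "recurrent M \<pi>' k" for k using i that by blast
  show "\<pi> j = \<pi>' j" using eq[OF neq[OF j(2)]] by simp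
  \<comment> \<open>Transitions of positive probability stay inside the recurrent states of
    \<open>\<pi>'\<close>, where the two policies agree, so the induction can be confined to
    them.\<close>
  have "first_passage M \<pi> j t k = first_passage M \<pi>' j t k" if "k \<in> X" "recurrent M \<pi>' k" for k t
    using that
  proof (induction t arbitrary: k)
    case 0
    then show ?case using eq[OF neq] by (simp add: trans_prob_def)
  next
    case (Suc t)
    have tp: "trans_prob M \<pi> k l = trans_prob M \<pi>' k l" for l
      using eq[OF neq[OF Suc.prems(2)]] by (simp add: trans_prob_def)
    have "trans_prob M \<pi> k l * first_passage M \<pi> j t l = trans_prob M \<pi>' k l * first_passage M \<pi>' j t l"
      if "l \<in> X" for l
    proof (cases "trans_prob M \<pi>' k l > 0")
      case True
      then show ?thesis
        using Suc.IH[OF that recurrent_closed[OF \<pi>(2) Suc.prems(1) that Suc.prems(2) True]] tp by simp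
    next
      case False
      then have "trans_prob M \<pi>' k l = 0" by (simp add: trans_prob_def pmf_nonneg less_le)
      then show ?thesis using tp by simp
    qed
    then show ?case by (auto intro: sum.cong)
  qed
  then have "(\<lambda>t. first_passage M \<pi> j t j) = (\<lambda>t. first_passage M \<pi>' j t j)" using j by blast
  then show "recurrent M \<pi> j" using j(2) by (simp add: recurrent_def)
qed

text \<open>Disjointness of the action sets lets \<open>m\<close> count state-action pairs, which
  serve as labels.\<close>

lemma num_actions_Sigma: "m = card (SIGMA i:X. actions M i)"
proof -
  have "m = (\<Sum>i\<in>X. card (actions M i))"
    unfolding num_actions_def all_actions_def using finite_mdp finite_actions
    by (intro card_UN_disjoint) (auto simp: finite_mdp_def disjoint_family_on_def)
  then show ?thesis by (simp add: card_SigmaI finite_actions)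
qed

text \<open>The \<open>n\<close> pairs \<open>(i, \<pi> i)\<close> lie outside the set; this is the
  origin of \<open>m - n\<close>. It is applied to actions of positive gap, with a policy whose own
  gaps vanish.\<close>

lemma card_pairs_le:
  assumes \<pi>: "\<pi> \<in> policies M" and Q: "\<And>i. i \<in> X \<Longrightarrow> \<not> Q i (\<pi> i)"
  shows "card {(i, a). i \<in> X \<and> a \<in> actions M i \<and> Q i a} + n \<le> m"
    and "finite {(i, a). i \<in> X \<and> a \<in> actions M i \<and> Q i a}"
proof -
  let ?Q = "{(i, a). i \<in> X \<and> a \<in> actions M i \<and> Q i a}" and ?P = "(\<lambda>i. (i, \<pi> i)) ` X"
  have fin: "finite (SIGMA i:X. actions M i)" by (intro finite_SigmaI finite_actions) auto
  then show finQ: "finite ?Q" by (rule finite_subset[rotated]) auto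
  have "card ?Q + n = card ?Q + card ?P" by (simp add: card_image inj_on_def)
  also have "\<dots> = card (?Q \<union> ?P)" using finQ Q by (subst card_Un_disjoint) auto
  also have "\<dots> \<le> card (SIGMA i:X. actions M i)"
    using fin policiesD[OF \<pi>] by (intro card_mono) auto
  finally show "card ?Q + n \<le> m" by (simp add: num_actions_Sigma)
qed

lemma ex_optimal_policy:
  "\<exists>\<pi>\<in>policies M. V \<pi> = opt_val M \<and> (\<forall>i\<in>X. \<forall>a\<in>actions M i. qval (V \<pi>) i a \<le> V \<pi> i)"
proof -
  \<comment> \<open>Finiteness gives a policy of maximal total value. An action with positive
    advantage would raise the total by \<open>performance_difference\<close>, since visits are at
    least \<open>1\<close>; so no action improves it, and it is best in every state at once.\<close>
  obtain \<pi> where \<pi>: "\<pi> \<in> policies M" "\<And>\<pi>'. \<pi>' \<in> policies M \<Longrightarrow> (\<Sum>i\<in>X. V \<pi>' i) \<le> (\<Sum>i\<in>X. V \<pi> i)"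
    using arg_min_if_finite(1)[OF finite_policies policies_nonempty, of "\<lambda>\<pi>. - (\<Sum>i\<in>X. V \<pi> i)"]
      arg_min_least[OF finite_policies policies_nonempty, of _ "\<lambda>\<pi>. - (\<Sum>i\<in>X. V \<pi> i)"]
    unfolding neg_le_iff_le by blast
  have q: "qval (V \<pi>) i a \<le> V \<pi> i" if i: "i \<in> X" "a \<in> actions M i" for i a
  proof (rule ccontr)
    assume *: "\<not> qval (V \<pi>) i a \<le> V \<pi> i"
    define \<pi>' where "\<pi>' = \<pi>(i := a)"
    have \<pi>': "\<pi>' \<in> policies M" unfolding \<pi>'_def by (rule policies_upd[OF \<pi>(1) i])
    have "0 < visits \<pi>' i * (qval (V \<pi>) i a - V \<pi> i)"
      using visits_ge_1[OF \<pi>' i(1)] * by simp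
    also have "\<dots> = (\<Sum>j\<in>X. if j = i then visits \<pi>' i * (qval (V \<pi>) i a - V \<pi> i) else 0)"
      using i by simp
    also have "\<dots> = (\<Sum>j\<in>X. visits \<pi>' j * (qval (V \<pi>) j (\<pi>' j) - V \<pi> j))"
      by (intro sum.cong refl) (simp add: \<pi>'_def val_qval[OF \<pi>(1)])
    also have "\<dots> = (\<Sum>j\<in>X. V \<pi>' j - V \<pi> j)" by (rule performance_difference[OF \<pi>', symmetric])
    finally show False using \<pi>(2)[OF \<pi>'] by (simp add: sum_subtractf)
  qed
  have le: "V \<pi>' i \<le> V \<pi> i" if "\<pi>' \<in> policies M" "i \<in> X" for \<pi>' i
    using that by (intro val_super_solution[OF that(1)] q policiesD) auto
  have "V \<pi> = opt_val M"
  proof (rule extensionalityI[OF val_extensional[OF \<pi>(1)]])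
    show "opt_val M \<in> extensional X" by (simp add: opt_val_def)
    show "V \<pi> i = opt_val M i" if "i \<in> X" for i
    proof -
      have "Max ((\<lambda>\<pi>. V \<pi> i) ` policies M) = V \<pi> i"
        using le[OF _ that] \<pi>(1) finite_policies by (intro Max_eqI) auto
      then show ?thesis using that by (simp add: opt_val_def)
    qed
  qed
  then show ?thesis using \<pi>(1) q by blast
qed

abbreviation "vopt \<equiv> opt_val M"

lemma qval_vopt_le:
  assumes "i \<in> X" "a \<in> actions M i"
  shows "qval vopt i a \<le> vopt i"
proof -
  obtain \<pi> where "V \<pi> = vopt" "\<forall>i\<in>X. \<forall>a\<in>actions M i. qval (V \<pi>) i a \<le> V \<pi> i"
    using ex_optimal_policy by blast
  then show ?thesis using assms by simp
qed

lemma val_le_vopt: "\<pi> \<in> policies M \<Longrightarrow> i \<in> X \<Longrightarrow> V \<pi> i \<le> vopt i"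
  by (rule val_super_solution) (auto intro: qval_vopt_le policiesD)

section \<open>The loss and the effect of one step\<close>

definition loss :: "(nat \<Rightarrow> 'a) \<Rightarrow> real" where
  "loss \<pi> = (\<Sum>i\<in>X. vopt i - V \<pi> i)"

lemma loss_nonneg: "\<pi> \<in> policies M \<Longrightarrow> 0 \<le> loss \<pi>"
  unfolding loss_def by (intro sum_nonneg) (simp add: val_le_vopt)

lemma loss_pos:
  assumes \<pi>: "\<pi> \<in> policies M" and "\<not> optimal M \<pi>"
  shows "0 < loss \<pi>"
proof (rule ccontr)
  assume "\<not> 0 < loss \<pi>"
  then have "loss \<pi> = 0" using loss_nonneg[OF \<pi>] by simp
  then have "\<forall>i\<in>X. vopt i - V \<pi> i = 0"
    unfolding loss_def using sum_nonneg_eq_0_iff[of X "\<lambda>i. vopt i - V \<pi> i"] val_le_vopt[OF \<pi>] by simp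
  then have "V \<pi> = vopt"
    by (intro extensionalityI[OF val_extensional[OF \<pi>]]) (auto simp: opt_val_def)
  then show False using assms(2) by (simp add: optimal_def)
qed

text \<open>All summands are nonnegative by \<open>qval_vopt_le\<close>, so each is at most the loss
  and one of them is at least an \<open>n\<close>-th of it.\<close>

lemma loss_eq:
  assumes "\<pi> \<in> policies M"
  shows "loss \<pi> = (\<Sum>i\<in>X. visits \<pi> i * (vopt i - qval vopt i (\<pi> i)))"
proof -
  have "loss \<pi> = - (\<Sum>i\<in>X. V \<pi> i - vopt i)"
    unfolding loss_def sum_negf[symmetric] minus_diff_eq ..
  then show ?thesis
    unfolding performance_difference[OF assms] sum_negf[symmetric] minus_mult_right minus_diff_eq .
qed

text \<open>What the counting needs of a simplex step, freed from the greedy policy and the choice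
  of a maximiser: the new action has the largest advantage among all actions of all states.\<close>

definition improves :: "(nat \<Rightarrow> 'a) \<Rightarrow> (nat \<Rightarrow> 'a) \<Rightarrow> nat \<Rightarrow> bool" where
  "improves \<pi> \<pi>' i \<longleftrightarrow> i \<in> X \<and> \<pi>' \<in> policies M \<and> (\<forall>j. j \<noteq> i \<longrightarrow> \<pi>' j = \<pi> j) \<and>
     (\<forall>j\<in>X. \<forall>a\<in>actions M j. qval (V \<pi>) j a - V \<pi> j \<le> qval (V \<pi>) i (\<pi>' i) - V \<pi> i)"

lemma bellman_ge_qval:
  assumes "j \<in> X" "a \<in> actions M j"
  shows "qval v j a \<le> bellman M v j"
proof -
  obtain \<pi> where \<pi>: "\<pi> \<in> policies M" using policies_nonempty by blast
  let ?\<pi> = "\<pi>(j := a)"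
  have "bellman_pol M ?\<pi> v j \<le> Max ((\<lambda>\<pi>. bellman_pol M \<pi> v j) ` policies M)"
    using finite_policies policies_upd[OF \<pi> assms] by (intro Max_ge) auto
  then show ?thesis using assms(1) by (simp add: bellman_pol_qval bellman_def)
qed

lemma simplex_step_improves:
  assumes \<pi>: "\<pi> \<in> policies M" and st: "simplex_step M \<pi> \<pi>'"
  shows "\<exists>i. improves \<pi> \<pi>' i"
proof -
  obtain g i where g: "greedy M (V \<pi>) g" and i: "is_arg_max (advantage M \<pi>) (\<lambda>j. j \<in> X) i"
    and \<pi>': "\<pi>' = switch g \<pi> {i}" using st by (auto simp: simplex_step_def)
  have iX: "i \<in> X" using i by (simp add: is_arg_max_def)
  have gp: "g \<in> policies M" and gb: "bellman_pol M g (V \<pi>) = bellman M (V \<pi>)"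
    using g by (auto simp: greedy_def)
  have adv: "advantage M \<pi> j = qval (V \<pi>) j (g j) - V \<pi> j" if "j \<in> X" for j
    using that by (simp add: advantage_def flip: gb bellman_pol_qval)
  have "\<pi>' = \<pi>(i := g i)" by (auto simp: \<pi>' switch_def)
  then have *: "\<pi>' \<in> policies M" "\<pi>' i = g i" "\<And>j. j \<noteq> i \<Longrightarrow> \<pi>' j = \<pi> j"
    using policies_upd[OF \<pi> iX policiesD[OF gp iX]] by auto
  have "qval (V \<pi>) j a - V \<pi> j \<le> qval (V \<pi>) i (\<pi>' i) - V \<pi> i" if "j \<in> X" "a \<in> actions M j" for j a
  proof -
    have "qval (V \<pi>) j a - V \<pi> j \<le> advantage M \<pi> j"
      using bellman_ge_qval[OF that, of "V \<pi>"] by (simp add: advantage_def)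
    also have "\<dots> \<le> advantage M \<pi> i" using i that by (auto simp: is_arg_max_linorder)
    also have "\<dots> = qval (V \<pi>) i (\<pi>' i) - V \<pi> i" using adv[OF iX] *(2) by simp
    finally show ?thesis .
  qed
  then show ?thesis unfolding improves_def using iX * by blast
qed

abbreviation gain :: "(nat \<Rightarrow> 'a) \<Rightarrow> (nat \<Rightarrow> 'a) \<Rightarrow> nat \<Rightarrow> real" where
  "gain \<pi> \<pi>' i \<equiv> qval (V \<pi>) i (\<pi>' i) - V \<pi> i"

lemma improves_sum:
  assumes \<pi>: "\<pi> \<in> policies M" and st: "improves \<pi> \<pi>' i"
  shows "(\<Sum>j\<in>X. V \<pi>' j - V \<pi> j) = visits \<pi>' i * gain \<pi> \<pi>' i"
proof -
  have i: "i \<in> X" and \<pi>': "\<pi>' \<in> policies M" and eq: "\<And>j. j \<noteq> i \<Longrightarrow> \<pi>' j = \<pi> j"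
    using st by (auto simp: improves_def)
  have "(\<Sum>j\<in>X. V \<pi>' j - V \<pi> j) = (\<Sum>j\<in>X. visits \<pi>' j * (qval (V \<pi>) j (\<pi>' j) - V \<pi> j))"
    by (rule performance_difference[OF \<pi>'])
  also have "\<dots> = (\<Sum>j\<in>X. if j = i then visits \<pi>' i * gain \<pi> \<pi>' i else 0)"
    by (intro sum.cong refl) (auto simp: eq val_qval[OF \<pi>])
  finally show ?thesis using i by simp
qed

lemma improves_gain_nonneg:
  assumes \<pi>: "\<pi> \<in> policies M" and st: "improves \<pi> \<pi>' i"
  shows "0 \<le> gain \<pi> \<pi>' i"
proof -
  obtain j where j: "j \<in> X" using states_nonempty by blast
  have "qval (V \<pi>) j (\<pi> j) - V \<pi> j \<le> gain \<pi> \<pi>' i"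
    using st j policiesD[OF \<pi> j] by (auto simp: improves_def)
  then show ?thesis using val_qval[OF \<pi> j] by simp
qed

lemma improves_mono:
  assumes \<pi>: "\<pi> \<in> policies M" and st: "improves \<pi> \<pi>' i" and j: "j \<in> X"
  shows "V \<pi> j \<le> V \<pi>' j"
proof (rule val_sub_solution[OF _ _ j])
  show "\<pi>' \<in> policies M" using st by (simp add: improves_def)
  show "V \<pi> k \<le> qval (V \<pi>) k (\<pi>' k)" if "k \<in> X" for k
    using st improves_gain_nonneg[OF \<pi> st] val_qval[OF \<pi> that]
    by (cases "k = i") (auto simp: improves_def)
qed

text \<open>Measured against \<open>V \<pi>\<close>, an optimal policy gains at most
  \<open>gain \<pi> \<pi>' i\<close> per visit, and its visits total
  \<open>n / (1 - \<gamma>)\<close>.\<close>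

lemma loss_le_gain:
  assumes \<pi>: "\<pi> \<in> policies M" and st: "improves \<pi> \<pi>' i"
  shows "loss \<pi> \<le> n / (1 - \<gamma>) * gain \<pi> \<pi>' i"
proof -
  obtain \<sigma> where \<sigma>: "\<sigma> \<in> policies M" "V \<sigma> = vopt" using ex_optimal_policy by blast
  have "loss \<pi> = (\<Sum>j\<in>X. visits \<sigma> j * (qval (V \<pi>) j (\<sigma> j) - V \<pi> j))"
    unfolding loss_def \<sigma>(2)[symmetric] by (rule performance_difference[OF \<sigma>(1)])
  also have "\<dots> \<le> (\<Sum>j\<in>X. visits \<sigma> j * gain \<pi> \<pi>' i)"
    using st policiesD[OF \<sigma>(1)] visits_ge_1[OF \<sigma>(1)]
    by (intro sum_mono mult_left_mono) (auto simp: improves_def intro: order_trans[OF zero_le_one])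
  finally show ?thesis by (simp add: visits_sum[OF \<sigma>(1)] flip: sum_distrib_right)
qed

lemma loss_step:
  assumes \<pi>: "\<pi> \<in> policies M" and st: "improves \<pi> \<pi>' i"
  shows "loss \<pi>' = loss \<pi> - visits \<pi>' i * gain \<pi> \<pi>' i"
  using improves_sum[OF assms] by (simp add: loss_def sum_subtractf)

end

section \<open>Counting iterations\<close>

text \<open>All occurrences of a label lie between its first one \<open>k\<close> and its last one
  \<open>l\<close>; the strict hypothesis makes room for \<open>l\<close> itself.\<close>

lemma card_le_sum_label_weights:
  fixes f :: "nat \<Rightarrow> 'l" and L :: "'l \<Rightarrow> nat"
  assumes T: "finite T" and F: "finite F" and f: "\<And>k. k \<in> T \<Longrightarrow> f k \<in> F"
    and gap: "\<And>k l. k \<in> T \<Longrightarrow> l \<in> T \<Longrightarrow> k \<le> l \<Longrightarrow> f k = f l \<Longrightarrow> card (T \<inter> {k..<l}) < L (f k)"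
  shows "card T \<le> sum L F"
proof -
  have "card {k\<in>T. f k = \<phi>} \<le> L \<phi>" for \<phi>
  proof (cases "{k\<in>T. f k = \<phi>} = {}")
    case True
    then show ?thesis by (simp only: card.empty)
  next
    case False
    let ?A = "{k\<in>T. f k = \<phi>}"
    have fin: "finite ?A" using T by simp
    define k l where "k = Min ?A" and "l = Max ?A"
    have kl: "k \<in> ?A" "l \<in> ?A" unfolding k_def l_def using Min_in[OF fin False] Max_in[OF fin False] by auto
    have between: "k \<le> j" "j \<le> l" if "j \<in> ?A" for j
      using that fin by (auto simp: k_def l_def)
    have "?A \<subseteq> insert l (T \<inter> {k..<l})" using between by fastforce
    then have "card ?A \<le> card (insert l (T \<inter> {k..<l}))" by (intro card_mono) auto
    also have "\<dots> \<le> Suc (card (T \<inter> {k..<l}))" by (rule card_insert_le_m1) auto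
    also have "\<dots> \<le> L \<phi>" using gap[of k l] kl between[of l] by auto
    finally show ?thesis .
  qed
  then have "(\<Sum>\<phi>\<in>F. card {k\<in>T. f k = \<phi>}) \<le> sum L F" by (intro sum_mono)
  moreover have "card T = (\<Sum>\<phi>\<in>F. card {k\<in>T. f k = \<phi>})"
    using card_eq_sum sum.group[OF T F, of f "\<lambda>_. 1::nat"] f by (simp add: image_subset_iff)
  ultimately show ?thesis by simp
qed

text \<open>\<open>T\<close> separates \<open>card T + 1\<close> stretches; removing its largest
  element splits off the last one.\<close>

lemma length_le_ticks_and_gaps:
  fixes N B :: nat
  assumes "T \<subseteq> {..<N}"
    and gap: "\<And>a b. a \<le> b \<Longrightarrow> b \<le> N \<Longrightarrow> {a..<b} \<inter> T = {} \<Longrightarrow> b - a \<le> B"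
  shows "N \<le> card T + (card T + 1) * B"
  using assms
proof (induction "card T" arbitrary: T N)
  case 0
  then have "T = {}" using finite_subset[OF 0(2)] by simp
  then show ?case using 0(3)[of 0 N] by simp
next
  case (Suc c)
  have fin: "finite T" using Suc.prems(1) finite_subset by blast
  have ne: "T \<noteq> {}" using Suc.hyps(2) by auto
  define t where "t = Max T"
  have t: "t \<in> T" "t < N" "\<And>s. s \<in> T \<Longrightarrow> s \<le> t"
    using Max_in[OF fin ne] Suc.prems(1) fin by (auto simp: t_def)
  have c: "c = card (T - {t})" using Suc.hyps(2) t(1) fin by simp
  have "t \<le> card (T - {t}) + (card (T - {t}) + 1) * B"
  proof (rule Suc.hyps(1)[OF c])
    show "T - {t} \<subseteq> {..<t}" using t(3) by (auto simp: less_le)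
    show "b - a \<le> B" if "a \<le> b" "b \<le> t" "{a..<b} \<inter> (T - {t}) = {}" for a b
      using that t(2) by (intro Suc.prems(2)) auto
  qed
  moreover have "N - Suc t \<le> B"
    using t(2,3) by (intro Suc.prems(2)) force+
  ultimately show ?case using Suc.hyps(2) t(2) by (simp add: c[symmetric])
qed

lemma contraction_power:
  fixes f :: "nat \<Rightarrow> real"
  assumes "0 \<le> q" "k \<le> l"
    and "\<And>i. k \<le> i \<Longrightarrow> i < l \<Longrightarrow> f (Suc i) \<le> f i"
    and "\<And>i. k \<le> i \<Longrightarrow> i < l \<Longrightarrow> i \<in> T \<Longrightarrow> f (Suc i) \<le> q * f i"
  shows "f l \<le> q ^ card (T \<inter> {k..<l}) * f k"
  using assms(2-)
proof (induction l rule: dec_induct)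
  case base
  then show ?case by simp
next
  case (step l)
  have IH: "f l \<le> q ^ card (T \<inter> {k..<l}) * f k" using step by simp
  have iv: "{k..<Suc l} = insert l {k..<l}" using step.hyps by auto
  show ?case
  proof (cases "l \<in> T")
    case True
    have "f (Suc l) \<le> q * f l" using step.prems(2)[of l] True step.hyps by simp
    also have "\<dots> \<le> q * (q ^ card (T \<inter> {k..<l}) * f k)" using IH assms(1) by (rule mult_left_mono)
    finally show ?thesis using True by (simp add: iv mult.assoc)
  next
    case False
    have "f (Suc l) \<le> f l" using step.prems(1)[of l] step.hyps by simp
    then show ?thesis using False IH by (simp add: iv)
  qed
qed

lemma ceiling_mult_ln_ge_1:
  fixes x z :: real
  assumes "0 < x" "1 < z"
  shows "1 \<le> \<lceil>x * ln z\<rceil>"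
  using assms by (simp add: one_le_ceiling)

lemma int_nat_ceiling_mult_ln:
  fixes x z :: real
  assumes "0 < x" "1 < z"
  shows "int (nat \<lceil>x * ln z\<rceil>) = \<lceil>x * ln z\<rceil>"
  using ceiling_mult_ln_ge_1[OF assms] by linarith

text \<open>From \<open>1 - 1 / y < exp (- (1 / y))\<close>. Strictness keeps \<open>c\<close> below
  the ceiling itself, so a label occurs at most \<open>nat \<lceil>y * ln z\<rceil>\<close> times
  without a further \<open>+ 1\<close>.\<close>

lemma geometric_decay_steps:
  fixes y z :: real
  assumes y: "1 \<le> y" and z: "1 < z" and c: "1 / z \<le> (1 - 1 / y) ^ c"
  shows "c < nat \<lceil>y * ln z\<rceil>"
proof -
  have pos: "0 < y * ln z" using y z by simp
  have "real c < y * ln z"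
  proof (cases "c = 0")
    case True
    then show ?thesis using pos by simp
  next
    case False
    have "1 - 1 / y < exp (- (1 / y))"
      using exp_minus_ge[of "1 / y"] exp_ge_add_one_self[of "- (1 / y)"] y
      by (smt (verit, best) divide_pos_pos exp_minus_greater)
    then have "(1 - 1 / y) ^ c < exp (- (1 / y)) ^ c"
      using y False by (intro power_strict_mono) auto
    also have "\<dots> = exp (- (c / y))" by (simp add: exp_of_nat_mult[symmetric])
    finally have "1 / z < exp (- (c / y))" using c by simp
    then have "ln (1 / z) < ln (exp (- (c / y)))" using z by (subst ln_less_cancel_iff) auto
    then show ?thesis using y z by (simp add: ln_div field_simps)
  qed
  then show ?thesis using pos by linarith
qed

text \<open>An initial piece of a run whose steps all start from non-optimal policies;
  \<open>\<pi> N\<close> itself may be optimal. \<open>n_ge_2\<close> makes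
  \<open>ln (n ^ 2)\<close> positive.\<close>

locale improvement_run = fin_mdp M for M :: "'a mdp" +
  fixes N :: nat and \<pi> :: "nat \<Rightarrow> nat \<Rightarrow> 'a" and sw :: "nat \<Rightarrow> nat" and \<tau>t \<tau>r :: real
  assumes pol: "k \<le> N \<Longrightarrow> \<pi> k \<in> policies M"
    and step: "k < N \<Longrightarrow> improves (\<pi> k) (\<pi> (Suc k)) (sw k)"
    and nonopt: "k < N \<Longrightarrow> \<not> optimal M (\<pi> k)"
    and \<tau>r: "recurrent_bound M \<tau>r" and \<tau>t: "transient_bound M \<tau>t"
    and \<tau>t_gt: "1 < real n ^ 2 * \<tau>t" and n_ge_2: "2 \<le> n"
begin

section \<open>Creating steps\<close>

definition creating :: "nat set" where
  "creating = {k. k < N \<and> recurrent M (\<pi> (Suc k)) (sw k)}"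

lemma visits_nonneg: "k \<le> N \<Longrightarrow> i \<in> X \<Longrightarrow> 0 \<le> visits (\<pi> k) i"
  using visits_ge_1[OF pol, of k i] by simp

lemma \<tau>r_ge_1: "1 \<le> \<tau>r"
  using ex_recurrent[OF pol[of 0]] recurrent_visits(1)[OF pol[of 0] _ _ \<tau>r] by blast

lemma \<tau>t_pos: "0 < \<tau>t"
  using \<tau>t_gt n_pos by (smt (verit) mult_nonneg_nonpos zero_le_power2)

lemma loss_decreasing:
  assumes "k < N"
  shows "loss (\<pi> (Suc k)) \<le> loss (\<pi> k)"
proof -
  have p: "\<pi> k \<in> policies M" "\<pi> (Suc k) \<in> policies M" using assms pol by auto
  have "sw k \<in> X" using step[OF assms] by (simp add: improves_def)
  then have "0 \<le> visits (\<pi> (Suc k)) (sw k)" using visits_ge_1[OF p(2)] by fastforce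
  then show ?thesis
    using loss_step[OF p(1) step[OF assms]] improves_gain_nonneg[OF p(1) step[OF assms]] by simp
qed

text \<open>The loss is at most \<open>n / (1 - \<gamma>)\<close> times the gain, and the switched
  state has at least \<open>1 / ((1 - \<gamma>) * \<tau>r)\<close> visits; the quotient is free of
  the discount factor.\<close>

lemma loss_contraction:
  assumes "k \<in> creating"
  shows "loss (\<pi> (Suc k)) \<le> (1 - 1 / (n * \<tau>r)) * loss (\<pi> k)"
proof -
  have k: "k < N" and r: "recurrent M (\<pi> (Suc k)) (sw k)" using assms by (auto simp: creating_def)
  have p: "\<pi> k \<in> policies M" "\<pi> (Suc k) \<in> policies M" using k pol by auto
  let ?g = "gain (\<pi> k) (\<pi> (Suc k)) (sw k)"
  have "sw k \<in> X" using step[OF k] by (simp add: improves_def)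
  then have v: "1 / ((1 - \<gamma>) * \<tau>r) \<le> visits (\<pi> (Suc k)) (sw k)"
    by (rule recurrent_visits(2)[OF p(2) _ r \<tau>r])
  have "1 / (n * \<tau>r) * loss (\<pi> k) \<le> 1 / (n * \<tau>r) * (n / (1 - \<gamma>) * ?g)"
    using \<tau>r_ge_1 by (intro mult_left_mono loss_le_gain[OF p(1) step[OF k]]) auto
  also have "\<dots> = 1 / ((1 - \<gamma>) * \<tau>r) * ?g"
    using n_pos \<tau>r_ge_1 discount by (simp add: field_simps)
  also have "\<dots> \<le> visits (\<pi> (Suc k)) (sw k) * ?g"
    by (intro mult_right_mono v improves_gain_nonneg[OF p(1) step[OF k]])
  finally show ?thesis
    unfolding loss_step[OF p(1) step[OF k]] by (simp add: algebra_simps)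
qed

lemma loss_power:
  assumes "k \<le> l" "l \<le> N"
  shows "loss (\<pi> l) \<le> (1 - 1 / (n * \<tau>r)) ^ card (creating \<inter> {k..<l}) * loss (\<pi> k)"
proof (rule contraction_power[where f = "\<lambda>k. loss (\<pi> k)"])
  have "1 * 1 \<le> n * \<tau>r" using \<tau>r_ge_1 n_pos by (intro mult_mono) auto
  then show "0 \<le> 1 - 1 / (n * \<tau>r)" by simp
qed (use assms loss_decreasing loss_contraction in auto)

text \<open>Step \<open>k\<close> is charged to a state carrying an \<open>n\<close>-th of the loss,
  with its action and a recurrence flag. The gap of a pair does not depend on \<open>k\<close>, so a
  later step with the same label has a loss at least its visits times this gap. The flag makes the
  upper bound on visits at \<open>k\<close> and the lower bound at \<open>l\<close> be of the same
  kind; its two values yield the two ceilings.\<close>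

lemma card_creating:
  "int (card creating) \<le> (int m - int n) *
     (\<lceil>n * \<tau>r * ln (n ^ 2 * \<tau>r)\<rceil> + \<lceil>n * \<tau>r * ln (n ^ 2 * \<tau>t)\<rceil>)"
proof -
  define gap where "gap i a = vopt i - qval vopt i a" for i a
  define A where "A = {(i, a). i \<in> X \<and> a \<in> actions M i \<and> 0 < gap i a}"
  define L1 where "L1 = nat \<lceil>n * \<tau>r * ln (n ^ 2 * \<tau>r)\<rceil>"
  define L2 where "L2 = nat \<lceil>n * \<tau>r * ln (n ^ 2 * \<tau>t)\<rceil>"
  have nr: "1 \<le> n * \<tau>r" using \<tau>r_ge_1 n_pos mult_mono[of 1 "real n" 1 \<tau>r] by simp
  have nnr: "1 < real n ^ 2 * \<tau>r"
    using mult_mono[of 2 "real n" 1 "n * \<tau>r"] nr n_ge_2 by (simp add: power2_eq_square mult.assoc)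
  obtain \<sigma> where \<sigma>: "\<sigma> \<in> policies M" "V \<sigma> = vopt" using ex_optimal_policy by blast
  have A: "card A + n \<le> m" "finite A"
    unfolding A_def using val_qval[OF \<sigma>(1)] \<sigma>(2)
    by (intro card_pairs_le[OF \<sigma>(1)]; simp add: gap_def)+
  have gap_nonneg: "0 \<le> gap i (\<pi> k i)" if "k \<le> N" "i \<in> X" for k i
    using qval_vopt_le[OF that(2) policiesD[OF pol[OF that(1)] that(2)]] by (simp add: gap_def)
  have "\<exists>s\<in>X. loss (\<pi> k) / n \<le> visits (\<pi> k) s * gap s (\<pi> k s)" if "k < N" for k
  proof (rule ccontr)
    assume "\<not> ?thesis"
    then have "(\<Sum>s\<in>X. visits (\<pi> k) s * gap s (\<pi> k s)) < (\<Sum>s\<in>X. loss (\<pi> k) / n)"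
      using states_nonempty by (intro sum_strict_mono) auto
    then show False using loss_eq[OF pol[of k]] that n_pos by (simp add: gap_def)
  qed
  then obtain s where s: "\<And>k. k < N \<Longrightarrow> s k \<in> X"
    "\<And>k. k < N \<Longrightarrow> loss (\<pi> k) / n \<le> visits (\<pi> k) (s k) * gap (s k) (\<pi> k (s k))" by metis
  define lab where "lab k = (recurrent M (\<pi> k) (s k), s k, \<pi> k (s k))" for k
  define L where "L = (\<lambda>(r :: bool, _ :: nat \<times> 'a). if r then L1 else L2)"
  have lp: "0 < loss (\<pi> k)" if "k < N" for k using loss_pos[OF pol nonopt] that by simp
  have vp: "1 \<le> visits (\<pi> k) (s k)" if "k < N" for k using visits_ge_1[OF pol s(1)] that by simp
  have gp: "0 < gap (s k) (\<pi> k (s k))" if "k < N" for k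
  proof -
    have "0 < loss (\<pi> k) / n" using lp[OF that] n_pos by simp
    then have "0 < visits (\<pi> k) (s k) * gap (s k) (\<pi> k (s k))" using s(2)[OF that] by linarith
    then show ?thesis using vp[OF that] by (simp add: zero_less_mult_iff)
  qed
  have "card creating \<le> sum L (UNIV \<times> A)"
  proof (rule card_le_sum_label_weights)
    show "finite creating" by (simp add: creating_def)
    show "finite ((UNIV :: bool set) \<times> A)" using A by simp
    show "lab k \<in> UNIV \<times> A" if "k \<in> creating" for k
      using that s(1) gp policiesD[OF pol s(1)] by (auto simp: lab_def A_def creating_def)
    show "card (creating \<inter> {k..<l}) < L (lab k)"
      if kl: "k \<in> creating" "l \<in> creating" "k \<le> l" "lab k = lab l" for k l
    proof -
      have N: "k < N" "l < N" using kl by (auto simp: creating_def)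
      let ?s = "s k" and ?g = "gap (s k) (\<pi> k (s k))"
      have same: "s l = ?s" "\<pi> l ?s = \<pi> k ?s" "recurrent M (\<pi> l) ?s = recurrent M (\<pi> k) ?s"
        using kl(4) by (auto simp: lab_def)
      have ll: "visits (\<pi> l) ?s * ?g \<le> loss (\<pi> l)"
      proof -
        have "visits (\<pi> l) ?s * gap ?s (\<pi> l ?s) \<le> (\<Sum>i\<in>X. visits (\<pi> l) i * gap i (\<pi> l i))"
          using N s(1) gap_nonneg by (intro member_le_sum mult_nonneg_nonneg visits_nonneg) auto
        then show ?thesis using loss_eq[OF pol[of l]] N same by (simp add: gap_def)
      qed
      let ?c = "card (creating \<inter> {k..<l})"
      have pw: "loss (\<pi> l) \<le> (1 - 1 / (n * \<tau>r)) ^ ?c * loss (\<pi> k)"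
        using kl(3) N by (intro loss_power) auto
      show ?thesis
      proof (cases "recurrent M (\<pi> k) ?s")
        case True
        \<comment> \<open>At most \<open>n / (1 - \<gamma>)\<close> visits at \<open>k\<close>
          against at least \<open>1 / ((1 - \<gamma>) * \<tau>r)\<close> at \<open>l\<close>: the
          fraction \<open>1 / (n ^ 2 * \<tau>r)\<close> of the loss remains.\<close>
        have "loss (\<pi> k) / n \<le> n / (1 - \<gamma>) * ?g"
          using N gp[OF N(1)] by (intro order_trans[OF s(2)] mult_right_mono visits_le pol s(1)) auto
        then have "1 / (n * \<tau>r) * (loss (\<pi> k) / n) \<le> 1 / (n * \<tau>r) * (n / (1 - \<gamma>) * ?g)"
          using nr by (intro mult_left_mono) auto
        then have "loss (\<pi> k) / (real n ^ 2 * \<tau>r) \<le> 1 / ((1 - \<gamma>) * \<tau>r) * ?g"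
          using n_pos by (simp add: power2_eq_square mult_ac)
        also have "\<dots> \<le> visits (\<pi> l) ?s * ?g"
          using recurrent_visits(2)[OF pol s(1) _ \<tau>r] N True same gp[OF N(1)]
          by (intro mult_right_mono) auto
        also note ll
        also note pw
        finally have "1 / (real n ^ 2 * \<tau>r) * loss (\<pi> k) \<le> (1 - 1 / (n * \<tau>r)) ^ ?c * loss (\<pi> k)" by simp
        then have "1 / (real n ^ 2 * \<tau>r) \<le> (1 - 1 / (n * \<tau>r)) ^ ?c"
          using lp[OF N(1)] by (rule mult_right_le_imp_le)
        from geometric_decay_steps[OF nr nnr this] show ?thesis
          using True by (simp add: L_def lab_def L1_def)
      next
        case False
        \<comment> \<open>At most \<open>n * \<tau>t\<close> visits at \<open>k\<close> against at
          least one at \<open>l\<close>.\<close>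
        have "loss (\<pi> k) / n \<le> n * \<tau>t * ?g"
          using N gp[OF N(1)]
          by (intro order_trans[OF s(2)] mult_right_mono transient_visits pol s(1) False \<tau>t) auto
        then have "loss (\<pi> k) / (real n ^ 2 * \<tau>t) \<le> 1 * ?g"
          using n_pos \<tau>t_pos by (simp add: field_simps power2_eq_square)
        also have "\<dots> \<le> visits (\<pi> l) ?s * ?g"
          using vp[OF N(2)] same gp[OF N(1)] by (intro mult_right_mono) auto
        also note ll
        also note pw
        finally have "1 / (real n ^ 2 * \<tau>t) * loss (\<pi> k) \<le> (1 - 1 / (n * \<tau>r)) ^ ?c * loss (\<pi> k)" by simp
        then have "1 / (real n ^ 2 * \<tau>t) \<le> (1 - 1 / (n * \<tau>r)) ^ ?c"
          using lp[OF N(1)] by (rule mult_right_le_imp_le)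
        from geometric_decay_steps[OF nr \<tau>t_gt this] show ?thesis
          using False by (simp add: L_def lab_def L2_def)
      qed
    qed
  qed
  also have "sum L (UNIV \<times> A) = card A * (L1 + L2)"
    by (simp add: L_def UNIV_bool sum.cartesian_product[symmetric] algebra_simps)
  also have "\<dots> \<le> (m - n) * (L1 + L2)" using A(1) by (intro mult_right_mono) auto
  finally have "int (card creating) \<le> int ((m - n) * (L1 + L2))" by (simp only: of_nat_le_iff)
  moreover have "int (m - n) = int m - int n" using A(1) by simp
  moreover have "int L1 = \<lceil>n * \<tau>r * ln (n ^ 2 * \<tau>r)\<rceil>" "int L2 = \<lceil>n * \<tau>r * ln (n ^ 2 * \<tau>t)\<rceil>"
    unfolding L1_def L2_def
    unfolding of_nat_power using nr nnr \<tau>t_gt by (intro int_nat_ceiling_mult_ln; linarith)+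
  ultimately show ?thesis by simp
qed

text \<open>A second name, because the inductions below bind \<open>step\<close> to their own
  case.\<close>

lemmas run_step = step

section \<open>Stretches without creating steps\<close>

lemma recurrent_backwards:
  assumes "k \<le> l" "l \<le> N" "{k..<l} \<inter> creating = {}" and j: "j \<in> X" "recurrent M (\<pi> l) j"
  shows "recurrent M (\<pi> k) j \<and> \<pi> k j = \<pi> l j"
  using assms(1-3)
proof (induction rule: inc_induct)
  case base
  then show ?case using j by simp
next
  case (step k)
  have iv: "{k..<l} = insert k {Suc k..<l}" using step.hyps by auto
  have IH: "recurrent M (\<pi> (Suc k)) j" "\<pi> (Suc k) j = \<pi> l j"
    using step.IH step.prems iv by auto
  have k: "k < N" using step by simp
  have "\<not> recurrent M (\<pi> (Suc k)) (sw k)" using step.prems(2) iv k by (auto simp: creating_def)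
  then have "recurrent M (\<pi> k) j" "\<pi> k j = \<pi> (Suc k) j"
    using recurrent_switch_transient[OF pol pol, of k "Suc k" "sw k" j] run_step[OF k] k j(1) IH(1)
    by (auto simp: improves_def)
  then show ?case using IH by simp
qed

text \<open>The recurrent states of \<open>\<pi> l\<close> are closed under \<open>\<pi> l\<close>,
  and by \<open>recurrent_backwards\<close> the two policies agree on them.\<close>

lemma val_eq_recurrent:
  assumes kl: "k \<le> l" "l \<le> N" "{k..<l} \<inter> creating = {}" and j: "j \<in> X" "recurrent M (\<pi> l) j"
  shows "V (\<pi> k) j = V (\<pi> l) j"
proof (rule val_eq_on_closed[symmetric])
  let ?T = "{i\<in>X. recurrent M (\<pi> l) i}"
  show "\<pi> l \<in> policies M" "\<pi> k \<in> policies M" using kl pol by auto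
  then show "j \<in> ?T" if "i \<in> ?T" "j \<in> X" "trans_prob M (\<pi> l) i j > 0" for i j
    using that recurrent_closed by blast
  show "\<pi> l i = \<pi> k i" if "i \<in> ?T" for i using recurrent_backwards[OF kl] that by simp
qed (use j in auto)

lemma val_mono: "k \<le> l \<Longrightarrow> l \<le> N \<Longrightarrow> i \<in> X \<Longrightarrow> V (\<pi> k) i \<le> V (\<pi> l) i"
proof (induction l rule: dec_induct)
  case (step l)
  then show ?case using improves_mono[OF pol run_step, of l i]
    by simp
qed simp

text \<open>
  The reference point is the last policy of the stretch instead of an optimal one. It agrees with
  the earlier policies on its own recurrent states, so only transient states contribute to the
  distance, and there \<open>visits\<close> is bounded independently of the discount factor. States that are
  recurrent now but not at the end are charged separately, once each.
\<close>

lemma noncreating_stretch: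
  assumes aK: "a \<le> K" "K \<le> N" and nc: "{a..<K} \<inter> creating = {}"
  shows "int (K - a) \<le> (int m - int n) * \<lceil>n ^ 2 * \<tau>t * ln (n ^ 2 * \<tau>t)\<rceil>
    + (int n - 1) * \<lceil>n ^ 2 * \<tau>t * ln (n ^ 2)\<rceil>"
proof -
  define y where "y = real n ^ 2 * \<tau>t"
  define gap where "gap i b = V (\<pi> K) i - qval (V (\<pi> K)) i b" for i b
  define w where "w k i = V (\<pi> K) i - V (\<pi> k) i" for k i
  define \<delta> where "\<delta> k = (\<Sum>i\<in>X. w k i)" for k
  define A where "A = {(i, b). i \<in> X \<and> b \<in> actions M i \<and> 0 < gap i b}"
  define R where "R = {i\<in>X. \<not> recurrent M (\<pi> K) i}"
  define L3 where "L3 = nat \<lceil>y * ln y\<rceil>"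
  define L4 where "L4 = nat \<lceil>y * ln (n ^ 2)\<rceil>"
  have y: "1 < y" using \<tau>t_gt by (simp add: y_def)
  have n2: "1 < real n ^ 2" using n_ge_2 by (simp add: one_less_power)
  have nc': "{k..<l} \<inter> creating = {}" if "a \<le> k" "l \<le> K" for k l
  proof -
    have "{k..<l} \<subseteq> {a..<K}" using that by auto
    then show ?thesis using nc by blast
  qed
  have polK: "\<pi> K \<in> policies M" using pol aK by simp
  have A: "card A + n \<le> m" "finite A"
    unfolding A_def using val_qval[OF polK] by (intro card_pairs_le[OF polK]; simp add: gap_def)+
  \<comment> \<open>The recurrent state of \<open>\<pi> K\<close> leaves at most
    \<open>n - 1\<close> labels of weight \<open>L4\<close>; the spare \<open>L4\<close> is spent in
    \<open>run_length\<close>.\<close>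
  have R: "card R + 1 \<le> n" "finite R"
  proof -
    obtain j where "j \<in> X" "recurrent M (\<pi> K) j" using ex_recurrent[OF polK] by blast
    then have "R \<subset> X" by (auto simp: R_def)
    then have "card R < card X" by (intro psubset_card_mono) auto
    then show "card R + 1 \<le> n" by simp
  qed (simp add: R_def)
  have w_nonneg: "0 \<le> w k i" if "k \<le> K" "i \<in> X" for k i
    using val_mono[OF that(1) aK(2) that(2)] by (simp add: w_def)
  have w_le: "w k i \<le> \<delta> k" if "k \<le> K" "i \<in> X" for k i
    unfolding \<delta>_def using that w_nonneg by (intro member_le_sum) auto
  have w_rec: "w k i = 0" if "a \<le> k" "k \<le> K" "i \<in> X" "recurrent M (\<pi> K) i" for k i
    using val_eq_recurrent[OF that(2) aK(2) nc'[OF that(1)] that(3,4)] by (simp add: w_def)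
  have gain_step: "\<delta> (Suc k) = \<delta> k - visits (\<pi> (Suc k)) (sw k) * gain (\<pi> k) (\<pi> (Suc k)) (sw k)"
    if "k < K" for k
  proof -
    have "\<delta> k - \<delta> (Suc k) = (\<Sum>i\<in>X. V (\<pi> (Suc k)) i - V (\<pi> k) i)"
      unfolding \<delta>_def w_def sum_subtractf[symmetric] by (simp add: algebra_simps)
    then show ?thesis using improves_sum[OF pol step, of k] that aK by linarith
  qed
  have gain_nonneg: "0 \<le> gain (\<pi> k) (\<pi> (Suc k)) (sw k)" if "k < K" for k
    using improves_gain_nonneg[OF pol step, of k] that aK by simp
  have sw: "sw k \<in> X" if "k < K" for k using step[of k] that aK by (simp add: improves_def)
  have gain_le: "gain (\<pi> k) (\<pi> (Suc k)) (sw k) \<le> \<delta> k - \<delta> (Suc k)" if "k < K" for k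
    using gain_step[OF that] mult_right_mono[OF visits_ge_1[OF pol sw[OF that]] gain_nonneg[OF that], of "Suc k"] that aK
    by simp
  have \<delta>_pos: "0 < \<delta> k" if "a \<le> k" "k < K" for k
  proof -
    \<comment> \<open>The factor \<open>n / (1 - \<gamma>)\<close> only serves to show that the gain
      is positive; it enters no constant.\<close>
    have "0 < loss (\<pi> k)" using loss_pos[OF pol nonopt, of k] that aK by simp
    also have "\<dots> \<le> n / (1 - \<gamma>) * gain (\<pi> k) (\<pi> (Suc k)) (sw k)"
      using loss_le_gain[OF pol step, of k] that aK by simp
    finally have "0 < gain (\<pi> k) (\<pi> (Suc k)) (sw k)"
      using discount by (auto simp: zero_less_mult_iff zero_less_divide_iff)
    moreover have "0 \<le> \<delta> (Suc k)" unfolding \<delta>_def using w_nonneg that by (intro sum_nonneg) auto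
    ultimately show ?thesis using gain_le[OF that(2)] by linarith
  qed
  have \<delta>_le_gain: "\<delta> k \<le> y * gain (\<pi> k) (\<pi> (Suc k)) (sw k)" (is "_ \<le> _ * ?g") if k: "a \<le> k" "k < K" for k
  proof -
    have polk: "\<pi> k \<in> policies M" using pol k aK by simp
    \<comment> \<open>Recurrent states of \<open>\<pi> K\<close> already have their final actions
      and contribute nothing; each other state contributes at most \<open>n * \<tau>t * ?g\<close>,
      and \<open>n\<close> summands give \<open>y\<close>.\<close>
    have "\<delta> k = (\<Sum>i\<in>X. visits (\<pi> K) i * (qval (V (\<pi> k)) i (\<pi> K i) - V (\<pi> k) i))"
      unfolding \<delta>_def w_def by (rule performance_difference[OF polK])
    also have "\<dots> \<le> (\<Sum>i\<in>X. n * \<tau>t * ?g)"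
    proof (rule sum_mono)
      fix i assume i: "i \<in> X"
      have ng: "0 \<le> n * \<tau>t * ?g" using gain_nonneg[OF k(2)] \<tau>t_pos by simp
      show "visits (\<pi> K) i * (qval (V (\<pi> k)) i (\<pi> K i) - V (\<pi> k) i) \<le> n * \<tau>t * ?g"
      proof (cases "recurrent M (\<pi> K) i")
        case True
        have "\<pi> K i = \<pi> k i" using recurrent_backwards[of k K i] nc' k aK i True by simp
        then show ?thesis using val_qval[OF polk i] ng by simp
      next
        case False
        have "qval (V (\<pi> k)) i (\<pi> K i) - V (\<pi> k) i \<le> ?g"
          using step[of k] k aK i policiesD[OF polK i] by (auto simp: improves_def)
        then have "visits (\<pi> K) i * (qval (V (\<pi> k)) i (\<pi> K i) - V (\<pi> k) i) \<le> visits (\<pi> K) i * ?g"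
          using visits_nonneg[OF aK(2) i] by (rule mult_left_mono)
        also have "\<dots> \<le> n * \<tau>t * ?g"
          using transient_visits[OF polK i False \<tau>t] gain_nonneg[OF k(2)] by (rule mult_right_mono)
        finally show ?thesis .
      qed
    qed
    finally show ?thesis by (simp add: y_def power2_eq_square mult.assoc)
  qed
  have contract: "\<delta> (Suc k) \<le> (1 - 1 / y) * \<delta> k" if "a \<le> k" "k < K" for k
  proof -
    have "\<delta> k / y \<le> gain (\<pi> k) (\<pi> (Suc k)) (sw k)"
      using \<delta>_le_gain[OF that] y by (simp add: pos_divide_le_eq mult.commute)
    then show ?thesis using gain_le[OF that(2)] by (simp add: algebra_simps)
  qed
  have power: "\<delta> l \<le> (1 - 1 / y) ^ card ({a..<K} \<inter> {k..<l}) * \<delta> k" if "a \<le> k" "k \<le> l" "l \<le> K" for k l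
  proof (rule contraction_power)
    show "\<delta> (Suc i) \<le> \<delta> i" if "k \<le> i" "i < l" for i
      using gain_le[of i] gain_nonneg[of i] that \<open>l \<le> K\<close> by simp
  qed (use that contract y in auto)

  \<comment> \<open>Origin of the thresholds: recurrent values below
    \<open>\<delta> k / n ^ 2\<close> account for at most \<open>n\<close> times that, which is
    \<open>\<delta> k / n\<close>, and at most \<open>n - 1\<close> transient terms, each below
    \<open>\<delta> k / n\<close>, cannot supply the rest.\<close>
  have "\<exists>s\<in>X. (recurrent M (\<pi> k) s \<and> \<delta> k / n ^ 2 \<le> w k s) \<or>
      (\<not> recurrent M (\<pi> k) s \<and> \<delta> k / n \<le> visits (\<pi> k) s * gap s (\<pi> k s))"
    if k: "a \<le> k" "k < K" for k
  proof (rule ccontr)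
    assume contra: "\<not> ?thesis"
    have polk: "\<pi> k \<in> policies M" using pol k aK by simp
    interpret discounted_chain X "trans_prob M (\<pi> k)" \<gamma> using polk by (rule chain)
    let ?T = "{i\<in>X. \<not> recurrent M (\<pi> k) i}"
    have eqT: "{i\<in>X. \<not> rec i} = ?T" by (simp add: recurrent_rec[OF polk])
    have "(\<Sum>i\<in>X. w k i) \<le> card X * (\<delta> k / n ^ 2) + (\<Sum>i\<in>{i\<in>X. \<not> rec i}. dmass i * gap i (\<pi> k i))"
    proof (rule sum_le_transient_part)
      show "w k i = gap i (\<pi> k i) + \<gamma> * (\<Sum>j\<in>X. trans_prob M (\<pi> k) i j * w k j)" if "i \<in> X" for i
        unfolding w_def qval_diff[symmetric] gap_def using val_qval[OF polk that] by simp
      show "w k i \<le> \<delta> k / n ^ 2" if "i \<in> X" "rec i" for i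
        using contra that by (auto simp: recurrent_rec[OF polk] not_le)
      show "0 \<le> \<delta> k / n ^ 2" using \<delta>_pos[OF k] by simp
    qed
    then have "\<delta> k \<le> \<delta> k / n + (\<Sum>i\<in>?T. visits (\<pi> k) i * gap i (\<pi> k i))"
      unfolding \<delta>_def[symmetric] eqT visits_def[symmetric] using n_pos by (simp add: power2_eq_square)
    moreover have "(\<Sum>i\<in>?T. visits (\<pi> k) i * gap i (\<pi> k i)) < \<delta> k - \<delta> k / n"
    proof (cases "?T = {}")
      case True
      have "\<delta> k / n < \<delta> k" using \<delta>_pos[OF k] n_ge_2 by (simp add: divide_less_eq)
      then show ?thesis unfolding True by simp
    next
      case False
      obtain j where "j \<in> X" "recurrent M (\<pi> k) j" using ex_recurrent[OF polk] by blast
      then have "?T \<subset> X" by auto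
      then have "card ?T < card X" by (intro psubset_card_mono) auto
      then have cT: "card ?T \<le> n - 1" by simp
      have "(\<Sum>i\<in>?T. visits (\<pi> k) i * gap i (\<pi> k i)) < (\<Sum>i\<in>?T. \<delta> k / n)"
        using False contra by (intro sum_strict_mono) (auto simp: not_le)
      also have "\<dots> = card ?T * (\<delta> k / n)" by (rule sum_constant)
      also have "\<dots> \<le> real (n - 1) * (\<delta> k / n)"
        using cT \<delta>_pos[OF k] by (intro mult_right_mono) auto
      also have "\<dots> = \<delta> k - \<delta> k / n" using n_pos by (simp add: of_nat_diff field_simps)
      finally show ?thesis .
    qed
    ultimately show False by simp
  qed
  then obtain s where s: "\<And>k. a \<le> k \<Longrightarrow> k < K \<Longrightarrow> s k \<in> X"
    "\<And>k. a \<le> k \<Longrightarrow> k < K \<Longrightarrow> recurrent M (\<pi> k) (s k) \<Longrightarrow> \<delta> k / n ^ 2 \<le> w k (s k)"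
    "\<And>k. a \<le> k \<Longrightarrow> k < K \<Longrightarrow> \<not> recurrent M (\<pi> k) (s k) \<Longrightarrow>
      \<delta> k / n \<le> visits (\<pi> k) (s k) * gap (s k) (\<pi> k (s k))"
    by metis
  have gap_ge: "\<delta> k / y \<le> gap (s k) (\<pi> k (s k))" and gap_pos: "0 < gap (s k) (\<pi> k (s k))"
    if k: "a \<le> k" "k < K" and nr: "\<not> recurrent M (\<pi> k) (s k)" for k
  proof -
    have polk: "\<pi> k \<in> policies M" using pol k aK by simp
    let ?g = "gap (s k) (\<pi> k (s k))"
    have "0 < \<delta> k / n" using \<delta>_pos[OF k] n_pos by simp
    then have "0 < visits (\<pi> k) (s k) * ?g" using s(3)[OF k nr] by linarith
    then show g: "0 < ?g" using visits_ge_1[OF polk s(1)[OF k]] by (simp add: zero_less_mult_iff)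
    have "\<delta> k / n \<le> n * \<tau>t * ?g"
      using g by (intro order_trans[OF s(3)[OF k nr]] mult_right_mono transient_visits[OF polk s(1)[OF k] nr \<tau>t]) auto
    then show "\<delta> k / y \<le> ?g"
      using n_pos \<tau>t_pos by (simp add: y_def field_simps power2_eq_square)
  qed
  \<comment> \<open>For a recurrent state no action is recorded: its value is the same at any two
    steps of the stretch at which it is recurrent. A transient state needs its action, whose gap is
    fixed.\<close>
  define lab where "lab k = (if recurrent M (\<pi> k) (s k) then Inl (s k) else Inr (s k, \<pi> k (s k)))" for k
  define L where "L = case_sum (\<lambda>_ :: nat. L4) (\<lambda>_ :: nat \<times> 'a. L3)"
  have "card {a..<K} \<le> sum L (R <+> A)"
  proof (rule card_le_sum_label_weights)
    show "finite (R <+> A)" using A R by simp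
    show "lab k \<in> R <+> A" if "k \<in> {a..<K}" for k
    proof (cases "recurrent M (\<pi> k) (s k)")
      case True
      have k: "a \<le> k" "k < K" using that by auto
      have "0 < \<delta> k / n ^ 2" using \<delta>_pos[OF k] n_pos by simp
      then have "w k (s k) \<noteq> 0" using s(2)[OF k True] by linarith
      then have "\<not> recurrent M (\<pi> K) (s k)" using w_rec[of k "s k"] k s(1)[OF k] by auto
      then show ?thesis using True s(1)[OF k] by (simp add: lab_def R_def InlI)
    next
      case False
      have k: "a \<le> k" "k < K" using that by auto
      then show ?thesis
        using False s(1)[OF k] gap_pos[OF k False] policiesD[OF pol s(1)[OF k]] aK by (simp add: lab_def A_def InrI)
    qed
    show "card ({a..<K} \<inter> {k..<l}) < L (lab k)"
      if kl: "k \<in> {a..<K}" "l \<in> {a..<K}" "k \<le> l" "lab k = lab l" for k l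
    proof -
      have k: "a \<le> k" "k < K" and l: "a \<le> l" "l < K" using kl by auto
      have same: "s l = s k" "recurrent M (\<pi> l) (s k) = recurrent M (\<pi> k) (s k)"
        using kl(4) by (auto simp: lab_def split: if_splits)
      let ?c = "card ({a..<K} \<inter> {k..<l})"
      have pw: "\<delta> l \<le> (1 - 1 / y) ^ ?c * \<delta> k" using power[of k l] k l kl(3) by simp
      have wl: "w l (s k) \<le> \<delta> l" using w_le[of l "s k"] l s(1)[OF k] by simp
      show ?thesis
      proof (cases "recurrent M (\<pi> k) (s k)")
        case True
        have "V (\<pi> k) (s k) = V (\<pi> l) (s k)"
          using val_eq_recurrent[OF kl(3) _ nc'[OF k(1)] s(1)[OF k]] same True l aK by simp
        then have "1 / real n ^ 2 * \<delta> k \<le> w l (s k)" using s(2)[OF k True] by (simp add: w_def)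
        also note wl
        also note pw
        finally have "1 / real n ^ 2 \<le> (1 - 1 / y) ^ ?c"
          using \<delta>_pos[OF k] by (rule mult_right_le_imp_le)
        from geometric_decay_steps[OF _ n2 this] show ?thesis
          using True y by (simp add: L_def lab_def L4_def)
      next
        case False
        have eq: "\<pi> l (s k) = \<pi> k (s k)" using kl(4) False same by (simp add: lab_def)
        \<comment> \<open>\<open>\<pi> K\<close> need not be optimal, so gaps may be negative and
          one summand of the sum formula need not be below \<open>\<delta> l\<close>. Instead,
          monotonicity of the values shows that a state still using the action lies below its final
          value by at least the gap.\<close>
        have "V (\<pi> l) (s k) = qval (V (\<pi> l)) (s k) (\<pi> k (s k))"
          using val_qval[OF pol s(1)[OF k], of l] eq l aK by simp
        also have "\<dots> \<le> qval (V (\<pi> K)) (s k) (\<pi> k (s k))"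
          using l aK by (intro qval_mono val_mono) auto
        finally have "gap (s k) (\<pi> k (s k)) \<le> w l (s k)" by (simp add: gap_def w_def)
        then have "1 / y * \<delta> k \<le> w l (s k)" using gap_ge[OF k False] by simp
        also note wl
        also note pw
        finally have "1 / y \<le> (1 - 1 / y) ^ ?c"
          using \<delta>_pos[OF k] by (rule mult_right_le_imp_le)
        from geometric_decay_steps[OF _ y this] show ?thesis
          using False y by (simp add: L_def lab_def L3_def)
      qed
    qed
  qed simp
  also have "sum L (R <+> A) = card R * L4 + card A * L3"
    using A R by (simp add: sum.Plus L_def)
  also have "\<dots> \<le> (n - 1) * L4 + (m - n) * L3"
    using A(1) R(1) by (intro add_mono mult_right_mono) auto
  finally have "int (K - a) \<le> int ((n - 1) * L4 + (m - n) * L3)" by (simp only: of_nat_le_iff card_atLeastLessThan)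
  moreover have "int (m - n) = int m - int n" "int (n - 1) = int n - 1"
    using A(1) n_pos by (simp_all add: of_nat_diff)
  moreover have "int L3 = \<lceil>y * ln y\<rceil>" "int L4 = \<lceil>y * ln (n ^ 2)\<rceil>"
    unfolding L3_def L4_def
    using y n2 by (intro int_nat_ceiling_mult_ln; simp)+
  ultimately show ?thesis by (simp add: y_def)
qed

text \<open>\<open>C\<close> creating steps and stretches of length at most \<open>B\<close> give at
  most \<open>C + (C + 1) * B = (C + 1) * (B + 1) - 1\<close> steps. The bound absorbs both
  \<open>+ 1\<close> because it has \<open>m * L1\<close> in place of \<open>(m - n) * L1\<close>
  and \<open>n * L4\<close> in place of \<open>(n - 1) * L4\<close>.\<close>

lemma run_length: "int N < iteration_bound n m \<tau>t \<tau>r"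
proof -
  define L1 where "L1 = \<lceil>n * \<tau>r * ln (n ^ 2 * \<tau>r)\<rceil>"
  define L2 where "L2 = \<lceil>n * \<tau>r * ln (n ^ 2 * \<tau>t)\<rceil>"
  define L3 where "L3 = \<lceil>n ^ 2 * \<tau>t * ln (n ^ 2 * \<tau>t)\<rceil>"
  define L4 where "L4 = \<lceil>n ^ 2 * \<tau>t * ln (n ^ 2)\<rceil>"
  define C where "C = int (card creating)"
  define B where "B = (int m - int n) * L3 + (int n - 1) * L4"
  have nr: "1 \<le> n * \<tau>r" using \<tau>r_ge_1 n_pos mult_mono[of 1 "real n" 1 \<tau>r] by simp
  have nnr: "1 < real n ^ 2 * \<tau>r"
    using mult_mono[of 2 "real n" 1 "n * \<tau>r"] nr n_ge_2 by (simp add: power2_eq_square mult.assoc)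
  have L: "1 \<le> L1" "0 \<le> L2" "0 \<le> L3" "1 \<le> L4"
  proof -
    have pos: "0 < n * \<tau>r" "0 < real n ^ 2 * \<tau>t" using nr \<tau>t_gt by linarith+
    have n2: "1 < real n ^ 2" using n_ge_2 by (simp add: one_less_power)
    show "1 \<le> L1" "0 \<le> L2" "0 \<le> L3" "1 \<le> L4"
      unfolding L1_def L2_def L3_def L4_def
      using ceiling_mult_ln_ge_1[OF pos(1) nnr] ceiling_mult_ln_ge_1[OF pos(1) \<tau>t_gt]
        ceiling_mult_ln_ge_1[OF pos(2) \<tau>t_gt] ceiling_mult_ln_ge_1[OF pos(2) n2] by (simp_all only: of_nat_power)
  qed
  have mn: "int n \<le> int m"
    using card_pairs_le(1)[OF pol[of 0], of "\<lambda>_ _. False"] by simp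
  have B0: "0 \<le> B" unfolding B_def using mn n_pos L by (intro add_nonneg_nonneg mult_nonneg_nonneg) auto
  have "N \<le> card creating + (card creating + 1) * nat B"
  proof (rule length_le_ticks_and_gaps)
    show "b - a \<le> nat B" if "a \<le> b" "b \<le> N" "{a..<b} \<inter> creating = {}" for a b
      using noncreating_stretch[OF that] B0 by (simp add: B_def L3_def L4_def)
  qed (auto simp: creating_def)
  then have "int N \<le> int (card creating + (card creating + 1) * nat B)" by (simp only: of_nat_le_iff)
  then have "int N \<le> C + (C + 1) * B" using B0 by (simp add: C_def algebra_simps)
  also have "\<dots> < (C + 1) * (B + 1)" by (simp add: algebra_simps)
  also have "\<dots> \<le> (int m * L1 + (int m - int n) * L2) * ((int m - int n) * L3 + int n * L4)"
  proof (rule mult_mono)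
    have "C \<le> (int m - int n) * (L1 + L2)"
      using card_creating by (simp add: C_def L1_def L2_def)
    moreover have "1 * 1 \<le> int n * L1" using n_pos L by (intro mult_mono) auto
    ultimately show "C + 1 \<le> int m * L1 + (int m - int n) * L2" by (simp add: algebra_simps)
    show "B + 1 \<le> (int m - int n) * L3 + int n * L4" using L by (simp add: B_def algebra_simps)
    show "0 \<le> int m * L1 + (int m - int n) * L2"
      using mn L by (intro add_nonneg_nonneg mult_nonneg_nonneg) auto
  qed (use B0 in auto)
  finally show ?thesis by (simp add: iteration_bound_def L1_def L2_def L3_def L4_def)
qed

end

section \<open>The soft-O estimate and the theorem\<close>

text \<open>All logarithms are at most \<open>L = ln g\<close>, so a ceiling of \<open>x * l\<close>
  is at most \<open>x * (L + 1)\<close>, and each bracket has two such terms. From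
  \<open>m >= 2\<close> follow \<open>g >= 2\<close> and \<open>L >= 1 / 2\<close>, hence
  \<open>L + 1 <= 3 * L\<close>, and \<open>(2 * 3) ^ 2 = 36\<close>.\<close>

lemma iteration_bound_le:
  fixes n m :: nat and \<tau>t \<tau>r :: real
  defines "g \<equiv> real n ^ 3 * real m ^ 2 * \<tau>t * \<tau>r"
  assumes n: "1 \<le> n" and nm: "n \<le> m" and m: "2 \<le> m" and t: "1 < real n ^ 2 * \<tau>t" and r: "1 \<le> \<tau>r"
  shows "\<bar>real_of_int (iteration_bound n m \<tau>t \<tau>r)\<bar> \<le> 36 * (g * ln g ^ 2)"
proof -
  define L where "L = ln g"
  have nr: "1 \<le> n * \<tau>r" using n r mult_mono[of 1 "real n" 1 \<tau>r] by simp
  have n1: "1 \<le> real n" "1 \<le> real m" using n m by auto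
  have t0: "0 < \<tau>t" using t by (smt (verit) mult_nonneg_nonpos zero_le_power2)
  have nmm: "real n * real n \<le> real n * real m ^ 2"
    using n1 nm mult_mono[of "real n" "real m" 1 "real m"] by (simp add: power2_eq_square)
  have "2 * 1 \<le> real m * (real m * (real n * \<tau>r))"
    using m n1 nr mult_mono[of 1 "real m" 1 "n * \<tau>r"] by (intro mult_mono) auto
  then have e: "2 \<le> real n * real m ^ 2 * \<tau>r" by (simp add: power2_eq_square mult_ac)
  have g1: "g = (real n ^ 2 * \<tau>t) * (real n * real m ^ 2 * \<tau>r)"
    by (simp add: g_def power2_eq_square power3_eq_cube)
  have g2: "g = (real n ^ 2 * \<tau>r) * (real n * real m ^ 2 * \<tau>t)"
    by (simp add: g_def power2_eq_square power3_eq_cube)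
  have tg: "real n ^ 2 * \<tau>t \<le> g" unfolding g1 using t e mult_left_mono[of 1 "real n * real m ^ 2 * \<tau>r" "real n ^ 2 * \<tau>t"] by simp
  have "1 \<le> real n * real n * \<tau>t" using t by (simp add: power2_eq_square)
  also have "\<dots> \<le> real n * real m ^ 2 * \<tau>t" using nmm t0 by (intro mult_right_mono) auto
  finally have rg: "real n ^ 2 * \<tau>r \<le> g"
    unfolding g2 using r mult_left_mono[of 1 "real n * real m ^ 2 * \<tau>t" "real n ^ 2 * \<tau>r"] by simp
  have ng: "real n ^ 2 \<le> g" using rg r mult_left_mono[of 1 \<tau>r "real n ^ 2"] by simp
  have "1 * 2 \<le> g" unfolding g1 using t e by (intro mult_mono) auto
  then have "ln 2 \<le> L" unfolding L_def by (intro ln_mono) auto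
  then have L: "1 / 2 \<le> L" using ln2_ge_two_thirds by simp
  have pos: "0 < real n ^ 2 * \<tau>t" "0 < real n ^ 2 * \<tau>r" "0 < real n ^ 2" using t r n by auto
  have ln: "ln (real n ^ 2 * \<tau>t) \<le> L" "ln (real n ^ 2 * \<tau>r) \<le> L" "ln (real n ^ 2) \<le> L"
    unfolding L_def using tg rg ng pos by (intro ln_mono; simp)+
  have "1 * 1 \<le> real n ^ 2 * \<tau>r" using n1 r by (intro mult_mono) auto
  then have ln0: "0 \<le> ln (real n ^ 2 * \<tau>t)" "0 \<le> ln (real n ^ 2 * \<tau>r)" "0 \<le> ln (real n ^ 2)"
    using t n1 by auto
  have ceil: "0 \<le> real_of_int \<lceil>x * l\<rceil>" "real_of_int \<lceil>x * l\<rceil> \<le> x * (L + 1)"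
    if "1 \<le> x" "0 \<le> l" "l \<le> L" for x l
  proof -
    have "0 \<le> x * l" using that by simp
    then show "0 \<le> real_of_int \<lceil>x * l\<rceil>" by simp
    have "real_of_int \<lceil>x * l\<rceil> \<le> x * l + 1" by linarith
    also have "\<dots> \<le> x * L + x" using that by (intro add_mono mult_left_mono) auto
    finally show "real_of_int \<lceil>x * l\<rceil> \<le> x * (L + 1)" by (simp add: algebra_simps)
  qed
  define b1 where "b1 = real m * real_of_int \<lceil>n * \<tau>r * ln (real n ^ 2 * \<tau>r)\<rceil>
    + (real m - real n) * real_of_int \<lceil>n * \<tau>r * ln (real n ^ 2 * \<tau>t)\<rceil>"
  define b2 where "b2 = (real m - real n) * real_of_int \<lceil>real n ^ 2 * \<tau>t * ln (real n ^ 2 * \<tau>t)\<rceil>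
    + real n * real_of_int \<lceil>real n ^ 2 * \<tau>t * ln (real n ^ 2)\<rceil>"
  have b: "real_of_int (iteration_bound n m \<tau>t \<tau>r) = b1 * b2"
    by (simp add: iteration_bound_def b1_def b2_def)
  note c1 = ceil[OF nr ln0(2) ln(2)] and c2 = ceil[OF nr ln0(1) ln(1)]
    and c3 = ceil[OF less_imp_le[OF t] ln0(1) ln(1)] and c4 = ceil[OF less_imp_le[OF t] ln0(3) ln(3)]
  have nm': "0 \<le> real m - real n" "real m - real n \<le> real m" "real n \<le> real m" using nm by auto
  have b1: "0 \<le> b1" "b1 \<le> real m * (n * \<tau>r * (L + 1)) + real m * (n * \<tau>r * (L + 1))"
    unfolding b1_def using nm' c1 c2 n1
    by (intro add_nonneg_nonneg mult_nonneg_nonneg add_mono mult_mono; simp)+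
  have b2: "0 \<le> b2" "b2 \<le> real m * (real n ^ 2 * \<tau>t * (L + 1)) + real m * (real n ^ 2 * \<tau>t * (L + 1))"
    unfolding b2_def using nm' c3 c4 n1
    by (intro add_nonneg_nonneg mult_nonneg_nonneg add_mono mult_mono; simp)+
  have "b1 * b2 \<le> (real m * (n * \<tau>r * (L + 1)) + real m * (n * \<tau>r * (L + 1))) *
      (real m * (real n ^ 2 * \<tau>t * (L + 1)) + real m * (real n ^ 2 * \<tau>t * (L + 1)))"
    by (intro mult_mono b1 b2 order_trans[OF b1])
  also have "\<dots> = g * (2 * (L + 1)) ^ 2"
    by (simp add: g_def power2_eq_square power3_eq_cube mult_ac)
  also have "\<dots> \<le> g * (6 * L) ^ 2"
    using L tg pos by (intro mult_left_mono power_mono) auto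
  finally show ?thesis using b1 b2 by (simp add: b L_def power_mult_distrib mult.left_commute)
qed

section \<open>Termination of every run\<close>

context fin_mdp
begin

text \<open>The only state receives all \<open>n / (1 - \<gamma>)\<close> visits, so by
  \<open>loss_le_gain\<close> the step removes the whole loss.\<close>

lemma single_state_improves_optimal:
  assumes \<pi>: "\<pi> \<in> policies M" and st: "improves \<pi> \<pi>' i" and n1: "n = 1"
  shows "optimal M \<pi>'"
proof (rule ccontr)
  assume *: "\<not> optimal M \<pi>'"
  have i: "i \<in> X" and \<pi>': "\<pi>' \<in> policies M" using st by (auto simp: improves_def)
  have "X = {i}" using i n1 by (auto simp: states_def)
  then have "visits \<pi>' i = n / (1 - \<gamma>)" using visits_sum[OF \<pi>'] by simp
  then have "loss \<pi>' \<le> 0" using loss_step[OF \<pi> st] loss_le_gain[OF \<pi> st] by simp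
  then show False using loss_pos[OF \<pi>' *] by simp
qed

lemma num_states_le_num_actions: "n \<le> m"
  using card_pairs_le(1)[of _ "\<lambda>_ _. False"] policies_nonempty by fastforce

text \<open>Needed for a single state, where the bound is \<open>0\<close> for \<open>m = 1\<close>
  and positive for \<open>m >= 2\<close>. Without an action of positive gap, \<open>loss_eq\<close>
  would leave no loss.\<close>

lemma not_optimal_num_actions:
  assumes \<pi>: "\<pi> \<in> policies M" and "\<not> optimal M \<pi>"
  shows "n < m"
proof -
  let ?g = "\<lambda>i a. vopt i - qval vopt i a"
  let ?A = "{(i, a). i \<in> X \<and> a \<in> actions M i \<and> 0 < ?g i a}"
  obtain \<sigma> where \<sigma>: "\<sigma> \<in> policies M" "V \<sigma> = vopt" using ex_optimal_policy by blast
  have A: "card ?A + n \<le> m" "finite ?A"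
    using val_qval[OF \<sigma>(1)] \<sigma>(2) by (intro card_pairs_le[OF \<sigma>(1)]; simp)+
  have "?A \<noteq> {}"
  proof
    assume "?A = {}"
    then have "?g i (\<pi> i) \<le> 0" if "i \<in> X" for i
      using that policiesD[OF \<pi> that] by (auto simp: not_less)
    then have "loss \<pi> \<le> 0"
      unfolding loss_eq[OF \<pi>] using visits_ge_1[OF \<pi>]
      by (intro sum_nonpos mult_nonneg_nonpos) (auto intro: order_trans[OF zero_le_one])
    then show False using loss_pos[OF assms] by simp
  qed
  then have "0 < card ?A" using A(2) by (simp add: card_gt_0_iff)
  then show ?thesis using A(1) by simp
qed

text \<open>Without transient states \<open>transient_bound\<close> holds vacuously, so both
  branches of the definition supply the same facts.\<close>

lemma structural_constants_bounds:
  assumes "structural_constants M \<tau>t \<tau>r"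
  shows "recurrent_bound M \<tau>r" "transient_bound M \<tau>t" "1 < real n ^ 2 * \<tau>t" "1 \<le> \<tau>r"
proof -
  show r: "recurrent_bound M \<tau>r" using assms by (simp add: structural_constants_def smallest_def)
  obtain \<pi> where \<pi>: "\<pi> \<in> policies M" using policies_nonempty by blast
  show "1 \<le> \<tau>r" using ex_recurrent[OF \<pi>] recurrent_visits(1)[OF \<pi> _ _ r] by blast
  show "transient_bound M \<tau>t" "1 < real n ^ 2 * \<tau>t"
  proof (atomize (full), cases "\<exists>\<pi>\<in>policies M. \<exists>i\<in>X. transient M \<pi> i")
    case True
    then have "transient_bound M \<tau>t" using assms by (simp add: structural_constants_def smallest_def)
    then show "transient_bound M \<tau>t \<and> 1 < real n ^ 2 * \<tau>t" using True transient_bound_ge by blast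
  next
    case False
    then have "1 < real n ^ 2 * \<tau>t" using assms unfolding structural_constants_def if_not_P[OF False] by blast
    moreover have "transient_bound M \<tau>t" using False by (auto simp: transient_bound_def)
    ultimately show "transient_bound M \<tau>t \<and> 1 < real n ^ 2 * \<tau>t" by simp
  qed
qed

lemma simplex_pi_terminates:
  assumes c: "structural_constants M \<tau>t \<tau>r" and run: "simplex_pi_run M \<pi>s"
  shows "\<exists>k. int k \<le> iteration_bound n m \<tau>t \<tau>r \<and> optimal M (\<pi>s k)"
proof -
  note b = structural_constants_bounds[OF c]
  have pol0: "\<pi>s 0 \<in> policies M" and st: "\<And>k. \<not> optimal M (\<pi>s k) \<Longrightarrow> simplex_step M (\<pi>s k) (\<pi>s (Suc k))"
    using run by (auto simp: simplex_pi_run_def)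
  show ?thesis
  proof (cases "n = 1")
    case False
    then have n2: "2 \<le> n" using n_pos by simp
    show ?thesis
    proof (rule ccontr)
      assume contra: "\<not> ?thesis"
      \<comment> \<open>\<open>nat\<close> of the bound is at least the bound, while
        \<open>run_length\<close> puts \<open>N\<close> strictly below it.\<close>
      define N where "N = nat (iteration_bound n m \<tau>t \<tau>r)"
      have nonopt: "\<not> optimal M (\<pi>s k)" if "k < N" for k using contra that by (auto simp: N_def)
      have pol: "\<pi>s k \<in> policies M" if "k \<le> N" for k
        using that
      proof (induction k)
        case (Suc k)
        then show ?case using simplex_step_improves[OF _ st[OF nonopt[of k]]] by (auto simp: improves_def)
      qed (rule pol0)
      have "\<forall>k. \<exists>i. k < N \<longrightarrow> improves (\<pi>s k) (\<pi>s (Suc k)) i"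
        using simplex_step_improves[OF pol st[OF nonopt]] by auto
      then obtain sw where sw: "\<And>k. k < N \<Longrightarrow> improves (\<pi>s k) (\<pi>s (Suc k)) (sw k)" by metis
      interpret improvement_run M N \<pi>s sw \<tau>t \<tau>r
        by unfold_locales (use pol sw nonopt b n2 in auto)
      show False using run_length unfolding N_def by linarith
    qed
  next
    case True
    \<comment> \<open>Here \<open>ln (n ^ 2) = 0\<close> removes the last term of the bound, which
      is therefore estimated directly; one step suffices.\<close>
    define L1 where "L1 = \<lceil>\<tau>r * ln \<tau>r\<rceil>"
    define L2 where "L2 = \<lceil>\<tau>r * ln \<tau>t\<rceil>"
    define L3 where "L3 = \<lceil>\<tau>t * ln \<tau>t\<rceil>"
    have t: "1 < \<tau>t" using b(3) True by simp
    have B: "iteration_bound n m \<tau>t \<tau>r = (int m * L1 + (int m - 1) * L2) * ((int m - 1) * L3)"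
      using True by (simp add: iteration_bound_def L1_def L2_def L3_def)
    have "0 \<le> \<tau>r * ln \<tau>r" "0 < \<tau>r * ln \<tau>t" "0 < \<tau>t * ln \<tau>t"
      using b(4) t by (auto intro!: mult_nonneg_nonneg mult_pos_pos)
    then have L: "0 \<le> L1" "1 \<le> L2" "1 \<le> L3"
      by (simp_all add: L1_def L2_def L3_def one_le_ceiling)
    have m1: "1 \<le> m" using num_states_le_num_actions True by simp
    show ?thesis
    proof (cases "optimal M (\<pi>s 0)")
      case opt: True
      have "0 \<le> iteration_bound n m \<tau>t \<tau>r"
        unfolding B using L m1 by (intro mult_nonneg_nonneg add_nonneg_nonneg) auto
      then show ?thesis using opt by (intro exI[of _ 0]) simp
    next
      case False
      have m2: "2 \<le> m" using not_optimal_num_actions[OF pol0 False] True by simp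
      obtain i where "improves (\<pi>s 0) (\<pi>s 1) i"
        using simplex_step_improves[OF pol0 st[OF False]] by auto
      then have opt: "optimal M (\<pi>s 1)" by (rule single_state_improves_optimal[OF pol0 _ True])
      have "0 \<le> int m * L1" using L by simp
      moreover have "1 * 1 \<le> (int m - 1) * L2" using L m2 by (intro mult_mono) auto
      moreover have "1 * 1 \<le> (int m - 1) * L3" using L m2 by (intro mult_mono) auto
      ultimately have "1 * 1 \<le> iteration_bound n m \<tau>t \<tau>r"
        unfolding B by (intro mult_mono) auto
      then show ?thesis using opt by (intro exI[of _ 1]) simp
    qed
  qed
qed

end

theorem theorem6:
  "(\<forall>(M :: 'a mdp) \<tau>\<^sub>t \<tau>\<^sub>r \<pi>s.
      finite_mdp M \<and> structural_constants M \<tau>\<^sub>t \<tau>\<^sub>r \<and> simplex_pi_run M \<pi>s \<longrightarrow>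
      (\<exists>k. int k \<le> iteration_bound (num_states M) (num_actions M) \<tau>\<^sub>t \<tau>\<^sub>r \<and> optimal M (\<pi>s k)))
   \<and> (\<lambda>(M, \<tau>\<^sub>t, \<tau>\<^sub>r). real_of_int (iteration_bound (num_states M) (num_actions M) \<tau>\<^sub>t \<tau>\<^sub>r))
      \<in> soft_bigo (principal (mdp_instances :: ('a mdp \<times> real \<times> real) set))
          (\<lambda>(M, \<tau>\<^sub>t, \<tau>\<^sub>r). real (num_states M) ^ 3 * real (num_actions M) ^ 2 * \<tau>\<^sub>t * \<tau>\<^sub>r)"
proof
  show "\<forall>(M :: 'a mdp) \<tau>\<^sub>t \<tau>\<^sub>r \<pi>s.
      finite_mdp M \<and> structural_constants M \<tau>\<^sub>t \<tau>\<^sub>r \<and> simplex_pi_run M \<pi>s \<longrightarrow>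
      (\<exists>k. int k \<le> iteration_bound (num_states M) (num_actions M) \<tau>\<^sub>t \<tau>\<^sub>r \<and> optimal M (\<pi>s k))"
    using fin_mdp.simplex_pi_terminates unfolding fin_mdp_def by blast
next
  define f where "f = (\<lambda>(M :: 'a mdp, \<tau>\<^sub>t, \<tau>\<^sub>r). real_of_int (iteration_bound (num_states M) (num_actions M) \<tau>\<^sub>t \<tau>\<^sub>r))"
  define g where "g = (\<lambda>(M :: 'a mdp, \<tau>\<^sub>t, \<tau>\<^sub>r). real (num_states M) ^ 3 * real (num_actions M) ^ 2 * \<tau>\<^sub>t * \<tau>\<^sub>r)"
  have "norm (f x) \<le> 36 * norm (g x * ln (g x) ^ 2)" if "x \<in> mdp_instances" for x
  proof -
    obtain M \<tau>t \<tau>r where x: "x = (M, \<tau>t, \<tau>r)" by (cases x)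
    have fM: "finite_mdp M" and c: "structural_constants M \<tau>t \<tau>r"
      using that by (auto simp: mdp_instances_def x)
    interpret fin_mdp M using fM by unfold_locales
    note b = structural_constants_bounds[OF c]
    show ?thesis
    proof (cases "m = 1")
      case True
      \<comment> \<open>For \<open>m = 1\<close> the value \<open>g x\<close> can be arbitrarily
        close to \<open>1\<close>, where its logarithm leaves no room, but the bound itself is
        \<open>0\<close>.\<close>
      then have "n = 1" using n_pos num_states_le_num_actions by simp
      then have "f x = 0" using True by (simp add: f_def x iteration_bound_def)
      then show ?thesis by simp
    next
      case False
      have "\<bar>f x\<bar> \<le> 36 * (g x * ln (g x) ^ 2)"
        unfolding f_def g_def x prod.case
        using n_pos num_states_le_num_actions False b by (intro iteration_bound_le) auto
      then show ?thesis by (simp add: order_trans)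
    qed
  qed
  then have "f \<in> O[principal mdp_instances](\<lambda>x. g x * ln (g x) ^ 2)"
    by (intro bigoI[where c = 36]) (simp add: eventually_principal)
  then show "(\<lambda>(M, \<tau>\<^sub>t, \<tau>\<^sub>r). real_of_int (iteration_bound (num_states M) (num_actions M) \<tau>\<^sub>t \<tau>\<^sub>r))
      \<in> soft_bigo (principal (mdp_instances :: ('a mdp \<times> real \<times> real) set))
          (\<lambda>(M, \<tau>\<^sub>t, \<tau>\<^sub>r). real (num_states M) ^ 3 * real (num_actions M) ^ 2 * \<tau>\<^sub>t * \<tau>\<^sub>r)"
    unfolding soft_bigo_def f_def[symmetric] g_def[symmetric] by blast
qed

end
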